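(* Let $\varepsilon,\delta\in(0,1)$, $N,C\in\mathbb{N}$ with $C\ge1$, and let $q_1,\dots,q_N:\mathcal{D}\to\mathbb{Z}$ be $1$-sensitive queries ($|q_i(d)-q_i(d')|\le1$ for adjacent $(d,d')$). Set $\varepsilon'=\dfrac{\varepsilon}{6\sqrt{2C\ln(2/\delta)}}$ and let $A,B\in\mathbb{Z}$ be fixed thresholds with $B-A\ge\frac{6}{\varepsilon'}\ln(4/\varepsilon')+\frac{2}{\varepsilon'}\ln(2/(\delta C))$. Consider the mechanism (Between Thresholds) which on input $d$ does: set $i:=1$, $\mathit{out}:=[\,]$; while $i\le N$ and $|\mathit{out}|<C$: draw $u\sim\mathrm{Lap}_{\varepsilon'}(0)$, set $a:=A-u$, $b:=B+u$, $\mathit{go}:=\mathrm{true}$; while $i\le N$ and $\mathit{go}$: draw $v\sim\mathrm{Lap}_{\varepsilon'/3}(q_i(d))$; if $a<v<b$ then draw $\mathit{noisy}\sim\mathrm{Lap}_{\varepsilon'}(q_i(d))$, prepend $(i,\mathit{noisy})$ to $\mathit{out}$, and set $\mathit{go}:=\mathrm{false}$; then set $i:=i+1$. Finally output $\mathit{out}$. All samples are drawn independently. Then this mechanism is $(\varepsilon,\delta)$-differentially private.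
   Context: $\mathcal{D}$ is a set of databases with a binary adjacency relation $\mathit{Adj}$. For $\lambda>0$ and $t\in\mathbb{Z}$, the discrete Laplace distribution $\mathrm{Lap}_\lambda(t)$ over $\mathbb{Z}$ gives $v$ probability $\exp(-\lambda|v-t|)/W$ with $W=\sum_{z\in\mathbb{Z}}\exp(-\lambda|z|)$. A mechanism $M$ mapping each $d\in\mathcal{D}$ to a distribution $M(d)$ over a countable output set $\mathcal{R}$ is $(\varepsilon,\delta)$-differentially private if $M(d)(S)\le e^{\varepsilon}M(d')(S)+\delta$ for all $(d,d')\in\mathit{Adj}$ and all $S\subseteq\mathcal{R}$. *)

theory Defs
  imports "HOL-Probability.Probability"
begin

text \<open>An output type of class \<open>countable\<close> is the countable output set.\<close>

definition differentially_private ::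
    "real \<Rightarrow> real \<Rightarrow> ('d \<times> 'd) set \<Rightarrow> ('d \<Rightarrow> 'r::countable pmf) \<Rightarrow> bool" where
  "differentially_private \<epsilon> \<delta> Adj M \<longleftrightarrow>
     (\<forall>(d, d') \<in> Adj. \<forall>S. measure_pmf.prob (M d) S \<le> exp \<epsilon> * measure_pmf.prob (M d') S + \<delta>)"

definition one_sensitive :: "('d \<times> 'd) set \<Rightarrow> ('d \<Rightarrow> int) \<Rightarrow> bool" where
  "one_sensitive Adj q \<longleftrightarrow> (\<forall>(d, d') \<in> Adj. \<bar>q d - q d'\<bar> \<le> 1)"

definition dlap_norm :: "real \<Rightarrow> real" where
  "dlap_norm lam = (\<Sum>\<^sub>\<infinity>z::int. exp (- lam * \<bar>real_of_int z\<bar>))"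

definition dlap :: "real \<Rightarrow> int \<Rightarrow> int pmf" where
  "dlap lam t = embed_pmf (\<lambda>v. exp (- lam * \<bar>real_of_int (v - t)\<bar>) / dlap_norm lam)"

text \<open>For \<open>lam > 0\<close> the weights sum to one, so \<open>embed_pmf\<close> yields the intended distribution;
  for \<open>lam \<le> 0\<close> the value of \<open>dlap\<close> is unspecified.\<close>

lemma dlap_summable:
  assumes "lam > 0"
  shows "(\<lambda>z::int. exp (- lam * \<bar>real_of_int z\<bar>)) summable_on UNIV"
proof -
  let ?f = "\<lambda>z::int. exp (- lam * \<bar>real_of_int z\<bar>)"
  have eq: "exp (- lam * real n) = exp (- lam) ^ n" for n
    by (metis exp_of_nat_mult mult.commute)
  have "(\<lambda>n. exp (- lam * real n)) summable_on (UNIV::nat set)"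
    unfolding eq using assms
    by (intro norm_summable_imp_summable_on) (simp add: norm_power summable_geometric)
  hence s: "(\<lambda>n. exp (- (lam * real n))) summable_on (UNIV::nat set)" by simp
  have 1: "?f summable_on range int"
    using s by (subst summable_on_reindex) (auto simp: o_def inj_def)
  have 2: "?f summable_on range (\<lambda>n. - int n)"
    using s by (subst summable_on_reindex) (auto simp: o_def inj_def)
  have "x \<in> range int \<union> range (\<lambda>n. - int n)" for x
    by (cases x rule: int_cases2) auto
  hence "UNIV = range int \<union> (range (\<lambda>n. - int n) - range int)" by blast
  moreover have "?f summable_on (range int \<union> (range (\<lambda>n. - int n) - range int))"
    by (intro summable_on_Un_disjoint 1 summable_on_subset_banach[OF 2]) auto
  ultimately show ?thesis by metis
qed

lemma pmf_dlap:
  assumes "lam > 0"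
  shows "pmf (dlap lam t) v = exp (- lam * \<bar>real_of_int (v - t)\<bar>) / dlap_norm lam"
proof -
  let ?f = "\<lambda>z::int. exp (- lam * \<bar>real_of_int z\<bar>)"
  note sm = dlap_summable[OF assms]
  have "sum ?f {0} \<le> infsum ?f UNIV"
    by (rule finite_sum_le_infsum[OF sm]) auto
  hence pos: "dlap_norm lam > 0" unfolding dlap_norm_def by simp
  have ab: "Infinite_Set_Sum.abs_summable_on ?f UNIV"
    using sm by (simp add: abs_summable_equivalent[symmetric])
  have nn: "(\<integral>\<^sup>+z. ennreal (?f z) \<partial>count_space UNIV) = ennreal (dlap_norm lam)"
    by (subst nn_integral_conv_infsetsum[OF ab])
       (use ab in \<open>auto simp: dlap_norm_def infsetsum_infsum\<close>)
  have "(\<integral>\<^sup>+v. ennreal (?f (v - t) / dlap_norm lam) \<partial>count_space UNIV)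
      = (\<integral>\<^sup>+v. ennreal (?f (v - t)) \<partial>count_space UNIV) / ennreal (dlap_norm lam)"
    using pos by (subst nn_integral_divide[symmetric]) (auto simp: divide_ennreal)
  also have "(\<integral>\<^sup>+v. ennreal (?f (v - t)) \<partial>count_space UNIV) = ennreal (dlap_norm lam)"
    using nn_integral_bij_count_space[of "\<lambda>v. v - t" UNIV UNIV "\<lambda>z. ennreal (?f z)"] nn
    by (simp add: bij_diff_right)
  finally show ?thesis unfolding dlap_def
    by (subst pmf_embed_pmf) (use pos in auto)
qed

text \<open>\<open>bt_inner\<close> and \<open>bt_outer\<close> are the two while loops. The loop state consists of the index
  \<open>i\<close>, the flag \<open>go\<close> and the output list \<open>out\<close>; each call returns the values of \<open>i\<close> and \<open>out\<close>
  upon leaving the loop. The queries are \<open>q 1, \<dots>, q N\<close>.\<close>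

function bt_inner ::
    "real \<Rightarrow> nat \<Rightarrow> (nat \<Rightarrow> 'd \<Rightarrow> int) \<Rightarrow> 'd \<Rightarrow> int \<Rightarrow> int \<Rightarrow>
     nat \<Rightarrow> bool \<Rightarrow> (nat \<times> int) list \<Rightarrow> (nat \<times> (nat \<times> int) list) pmf" where
  "bt_inner \<epsilon>' N q d a b i go out =
     (if i \<le> N \<and> go then
        do {
          v \<leftarrow> dlap (\<epsilon>' / 3) (q i d);
          (out', go') \<leftarrow>
            (if a < v \<and> v < b then
               do {
                 noisy \<leftarrow> dlap \<epsilon>' (q i d);
                 return_pmf ((i, noisy) # out, False)
               }
             else return_pmf (out, True));
          bt_inner \<epsilon>' N q d a b (i + 1) go' out'
        }
      else return_pmf (i, out))"
  by pat_completeness auto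
termination
  by (relation "Wellfounded.measure (\<lambda>(\<epsilon>', N, q, d, a, b, i, go, out). N + 1 - i)")
     (simp, simp only: in_measure split_conv, linarith)

declare bt_inner.simps [simp del]

lemma bt_inner_step:
  assumes "r \<in> set_pmf (bt_inner \<epsilon>' N q d a b i go out)" "i \<le> N" go
  obtains go' out' where "r \<in> set_pmf (bt_inner \<epsilon>' N q d a b (i + 1) go' out')"
proof -
  have "r \<in> set_pmf (bt_inner \<epsilon>' N q d a b i go out) \<longrightarrow>
      (\<exists>go' out'. r \<in> set_pmf (bt_inner \<epsilon>' N q d a b (i + 1) go' out'))"
    unfolding bt_inner.simps[of \<epsilon>' N q d a b i go out] if_P[OF conjI[OF assms(2,3)]]
    by (simp only: set_bind_pmf case_prod_beta) blast
  with assms(1) that show thesis by blast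
qed

lemma bt_inner_index_ge: "r \<in> set_pmf (bt_inner \<epsilon>' N q d a b i go out) \<Longrightarrow> i \<le> fst r"
proof (induction "N + 1 - i" arbitrary: i go out rule: less_induct)
  case less
  show ?case
  proof (cases "i \<le> N \<and> go")
    case True
    with bt_inner_step[OF less.prems] obtain go' out'
      where "r \<in> set_pmf (bt_inner \<epsilon>' N q d a b (i + 1) go' out')" by metis
    moreover have "N + 1 - (i + 1) < N + 1 - i" using True by linarith
    ultimately have "i + 1 \<le> fst r" by (rule less.hyps[rotated])
    then show ?thesis by linarith
  next
    case False
    then have "r \<in> set_pmf (return_pmf (i, out))"
      using less.prems unfolding bt_inner.simps[of \<epsilon>' N q d a b i go out] by (simp only: if_False)
    then show ?thesis by simp
  qed
qed

text \<open>The index increases in every run of the inner loop, so the outer loop terminates.\<close>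

lemma bt_inner_index_gr:
  assumes "r \<in> set_pmf (bt_inner \<epsilon>' N q d a b i True out)" "i \<le> N"
  shows "i < fst r"
proof -
  from bt_inner_step[OF assms TrueI] obtain go' out'
    where "r \<in> set_pmf (bt_inner \<epsilon>' N q d a b (i + 1) go' out')" .
  from bt_inner_index_ge[OF this] show ?thesis by linarith
qed

function bt_outer ::
    "real \<Rightarrow> nat \<Rightarrow> nat \<Rightarrow> int \<Rightarrow> int \<Rightarrow> (nat \<Rightarrow> 'd \<Rightarrow> int) \<Rightarrow> 'd \<Rightarrow>
     nat \<Rightarrow> (nat \<times> int) list \<Rightarrow> (nat \<times> int) list pmf" where
  "bt_outer \<epsilon>' N C A B q d i out =
     (if i \<le> N \<and> length out < C then
        do {
          u \<leftarrow> dlap \<epsilon>' 0;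
          (i', out') \<leftarrow> bt_inner \<epsilon>' N q d (A - u) (B + u) i True out;
          bt_outer \<epsilon>' N C A B q d i' out'
        }
      else return_pmf out)"
  by pat_completeness auto
termination
proof (relation "Wellfounded.measure (\<lambda>(\<epsilon>', N, C, A, B, q, d, i, out). N + 1 - i)")
  fix \<epsilon>' :: real and N C i i' :: nat and A B u :: int and q :: "nat \<Rightarrow> 'd \<Rightarrow> int" and d :: 'd
    and out out' :: "(nat \<times> int) list" and r :: "nat \<times> (nat \<times> int) list"
  assume c: "i \<le> N \<and> length out < C"
    and r: "r \<in> set_pmf (bt_inner \<epsilon>' N q d (A - u) (B + u) i True out)" and e: "(i', out') = r"
  have "i < i'" using bt_inner_index_gr[OF r] c by (simp flip: e)
  with c show "((\<epsilon>', N, C, A, B, q, d, i', out'), (\<epsilon>', N, C, A, B, q, d, i, out))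
      \<in> Wellfounded.measure (\<lambda>(\<epsilon>', N, C, A, B, q, d, i, out). N + 1 - i)"
    by (simp add: diff_less_mono2)
qed simp

declare bt_outer.simps [simp del]

definition between_thresholds ::
    "real \<Rightarrow> nat \<Rightarrow> nat \<Rightarrow> int \<Rightarrow> int \<Rightarrow> (nat \<Rightarrow> 'd \<Rightarrow> int) \<Rightarrow> 'd \<Rightarrow> (nat \<times> int) list pmf" where
  "between_thresholds \<epsilon>' N C A B q d = bt_outer \<epsilon>' N C A B q d 1 []"

end

theory Submission
  imports Defs
begin

text \<open>
  In a run of the inner loop, shift the threshold noise \<open>u\<close> by one, which moves both thresholds
  inwards by one: queries that missed the interval on \<open>d\<close> still miss it on \<open>d'\<close>, and an interval
  with \<open>k \<ge> 3\<close> integers is hit with probability at most \<open>exp (2 * \<epsilon>' / 3) * k / (k - 2)\<close> times that of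
  the shrunk interval. Together with the two noise shifts this costs \<open>3 * \<epsilon>'\<close> as soon as
  \<open>k - 2 \<ge> 6 / \<epsilon>'\<close>.

  The gap \<open>B - A\<close> is not large enough to neglect, with probability \<open>1 - \<delta> / (2 * C)\<close> per run, all
  shorter intervals when \<open>C\<close> is huge. But an interval without integers never leaks, and a single
  value of \<open>u\<close> in the short range has probability of order \<open>\<epsilon>' ^ 4 * \<delta> * C\<close>, i.e. \<open>\<delta> / C\<close> up to a small
  factor. So only the \<open>u\<close> with \<open>1 \<le> k\<close> below a cutoff of order \<open>s\<close> are charged to \<open>\<delta>\<close>.
  For larger \<open>k\<close> the loss is \<open>O(1 / k)\<close>, and since the likelihood ratio of a run has mean at most
  one, only the squares \<open>O(1 / k\<^sup>2)\<close> enter its moment of order \<open>1 + s\<close>; their sum converges.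

  Runs are composed through the bound \<open>P S \<le> t * Q S + \<Phi> ^ m * t powr - s + m * \<delta>\<^sub>0\<close> for all \<open>t > 0\<close>,
  where \<open>m\<close> is the number of outputs still to come and \<open>\<Phi>\<close> bounds the moment of one run. The theorem
  is the case \<open>t = exp \<epsilon>\<close> with \<open>s = 3 * ln (2 / \<delta>) / \<epsilon>\<close>.
\<close>

section \<open>Moments of the likelihood ratio\<close>

text \<open>The convex function \<open>y powr (1 + s)\<close> minus its tangent at \<open>1\<close>; the linear part is what the
  mean of the likelihood ratio controls.\<close>

definition excess :: "real \<Rightarrow> real \<Rightarrow> real" where
  "excess s y = y powr (1 + s) - 1 - (1 + s) * (y - 1)"

text \<open>For \<open>x \<le> 1\<close> the polynomial \<open>1 + x + x\<^sup>2\<close> fits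
  between the two sides; for \<open>x > 1\<close> already \<open>x \<le> x\<^sup>2\<close>.\<close>

lemma exp_le_add_exp_square: "exp x \<le> x + exp (x\<^sup>2)" for x :: real
proof (cases "x \<le> 1")
  case True
  have "exp x \<le> 1 + x + x\<^sup>2"
  proof (cases "x \<ge> 0")
    case True
    from this \<open>x \<le> 1\<close> show ?thesis by (rule exp_bound)
  next
    case False
    show ?thesis
    proof (cases "x \<le> -1")
      case True
      have "exp x \<le> 1" using True by simp
      moreover have "x * (1 + x) \<ge> 0" using True by (intro mult_nonpos_nonpos) auto
      then have "x + x\<^sup>2 \<ge> 0" by (simp add: power2_eq_square algebra_simps)
      ultimately show ?thesis by linarith
    next
      case f: False
      \<comment> \<open>Both sides get multiplied by \<open>1 - x > 0\<close>: the left one becomes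
        at most \<open>1\<close>, the right one \<open>1 - x ^ 3\<close>, which is at least
        \<open>1\<close> for negative \<open>x\<close>.\<close>
      have "1 / exp x = exp (- x)" by (simp add: exp_minus inverse_eq_divide)
      also have "1 + (- x) \<le> exp (- x)" by (rule exp_ge_add_one_self)
      finally have "1 - x \<le> 1 / exp x" by simp
      then have "(1 - x) * exp x \<le> 1" by (simp add: field_simps)
      moreover have "(1 - x) * (1 + x + x\<^sup>2) = 1 - x ^ 3" by (simp add: algebra_simps power2_eq_square power3_eq_cube)
      moreover have "x ^ 3 \<le> 0" using False by (simp add: power_le_zero_eq)
      ultimately have "(1 - x) * exp x \<le> (1 - x) * (1 + x + x\<^sup>2)" by linarith
      with False show ?thesis by simp
    qed
  qed
  moreover have "1 + x\<^sup>2 \<le> exp (x\<^sup>2)" by (rule exp_ge_add_one_self)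
  ultimately show ?thesis by linarith
next
  case False
  then have "x * 1 \<le> x * x" by (intro mult_left_mono) auto
  then have "exp x \<le> exp (x\<^sup>2)" by (simp add: power2_eq_square)
  with False show ?thesis by linarith
qed

text \<open>Since \<open>exp y - 1 \<ge> y\<close>, the tangent part cancels the linear term of
  \<open>exp ((1 + s) * y)\<close>. The bound is even in \<open>y\<close>, so it serves for losses
  of either sign.\<close>

lemma excess_exp:
  assumes "s > 0"
  shows "excess s (exp y) \<le> exp (((1 + s) * y)\<^sup>2) - 1"
proof -
  have "(1 + s) * y \<le> (1 + s) * (exp y - 1)"
    using assms exp_ge_add_one_self[of y] by (intro mult_left_mono) linarith+
  then show ?thesis
    using exp_le_add_exp_square[of "(1 + s) * y"] by (simp add: excess_def exp_powr_real mult.commute)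
qed

lemma powr_tangent:
  fixes x y s :: real
  assumes "s > 0" "x \<ge> 0" "y \<ge> 0"
  shows "y powr (1 + s) \<ge> x powr (1 + s) + (1 + s) * x powr s * (y - x)"
proof (cases "x = 0 \<or> y = 0")
  case True
  \<comment> \<open>The endpoint lies outside the open half-line on which the derivative argument
    runs. It does occur: likelihood ratios and the weights \<open>lo\<close> may vanish.\<close>
  have "x powr (1 + s) = x * x powr s" using assms by (cases "x = 0") (auto simp: powr_add)
  then show ?thesis using True assms by (auto simp: algebra_simps)
next
  case False
  have "(\<lambda>x. x powr (1 + s)) y - (\<lambda>x. x powr (1 + s)) x \<ge> ((1 + s) * x powr s) * (y - x)"
  proof (rule convex_on_imp_above_tangent[where A = "{0<..}"])
    show "convex_on {0<..} (\<lambda>x. x powr (1 + s))"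
    proof (rule f''_ge0_imp_convex)
      fix x :: real assume "x \<in> {0<..}"
      then show "((\<lambda>x. x powr (1 + s)) has_real_derivative (1 + s) * x powr s) (at x)"
        by (auto intro!: derivative_eq_intros)
      from \<open>x \<in> {0<..}\<close> show "((\<lambda>x. (1 + s) * x powr s) has_real_derivative (1 + s) * (s * x powr (s - 1))) (at x)"
        by (auto intro!: derivative_eq_intros)
      show "(1 + s) * (s * x powr (s - 1)) \<ge> 0" using assms by simp
    qed auto
    show "((\<lambda>x. x powr (1 + s)) has_real_derivative (1 + s) * x powr s) (at x within {0<..})"
      using False assms by (auto intro!: derivative_eq_intros)
  qed (use False assms in \<open>auto simp: interior_open\<close>)
  then show ?thesis by simp
qed

lemma excess_tangent:
  assumes "s > 0" "x \<ge> 0" "y \<ge> 0"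
  shows "excess s y \<ge> excess s x + (1 + s) * (x powr s - 1) * (y - x)"
  using powr_tangent[OF assms] by (simp add: excess_def algebra_simps)

lemma integrable_pmf_bounded:
  fixes h :: "'a \<Rightarrow> real"
  assumes "\<And>x. \<bar>h x\<bar> \<le> c"
  shows "integrable (measure_pmf p) h"
  using assms by (intro measure_pmf.integrable_const_bound[where B = c]) auto

text \<open>If \<open>X / Q\<close> lies between averages of \<open>lo\<close> and of \<open>hi\<close> with weights \<open>g\<close>, a tangent line at \<open>X / Q\<close>
  yields Jensen's inequality on whichever side of \<open>1\<close> it lies.\<close>

lemma moment_pointwise:
  fixes p :: "'u pmf" and g hi lo G :: "'u \<Rightarrow> real"
  assumes s: "s > 0"
    and g: "\<And>u. 0 \<le> g u" "\<And>u. g u \<le> 1"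
    and hi: "\<And>u. 1 \<le> hi u" "\<And>u. hi u \<le> H"
    and lo: "\<And>u. 0 \<le> lo u" "\<And>u. lo u \<le> 1"
    and G: "\<And>u. excess s (hi u) \<le> G u" "\<And>u. excess s (lo u) \<le> G u" "\<And>u. 0 \<le> G u" "\<And>u. G u \<le> K"
    and X: "(\<integral>u. lo u * g u \<partial>p) \<le> X" "X \<le> (\<integral>u. hi u * g u \<partial>p)"
  defines "Q \<equiv> (\<integral>u. g u \<partial>p)"
  shows "Q * (X / Q) powr (1 + s) + s * Q \<le> (1 + s) * X + (\<integral>u. G u * g u \<partial>p)"
proof -
  have int: "integrable (measure_pmf p) (\<lambda>u. h u * g u)"
    if "\<And>u. 0 \<le> h u" "\<And>u. h u \<le> c" for h and c :: real
  proof (rule integrable_pmf_bounded[where c = c])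
    fix u
    have "h u * g u \<le> c * 1" using that g by (intro mult_mono) (auto intro: order_trans)
    then show "\<bar>h u * g u\<bar> \<le> c" using that g by (simp add: abs_mult)
  qed
  have ihi: "integrable p (\<lambda>u. hi u * g u)" using hi by (intro int) (auto intro: order_trans[of 0 1])
  have ilo: "integrable p (\<lambda>u. lo u * g u)" using lo by (intro int)
  have iG: "integrable p (\<lambda>u. G u * g u)" using G by (intro int)
  have ig: "integrable p (\<lambda>u. g u)" using int[of "\<lambda>_. 1" 1] by simp
  have "(\<integral>u. lo u * g u \<partial>p) \<ge> 0"
    using lo g by (intro Bochner_Integration.integral_nonneg) auto
  with X(1) have X0: "X \<ge> 0" by linarith
  have G0: "(\<integral>u. G u * g u \<partial>p) \<ge> 0"
    using G g by (intro Bochner_Integration.integral_nonneg) auto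
  have Q0: "Q \<ge> 0" unfolding Q_def using g by (intro Bochner_Integration.integral_nonneg) auto
  show ?thesis
  proof (cases "Q = 0")
    case True
    then show ?thesis using X0 G0 s by simp
  next
    case False
    with Q0 have Q: "Q > 0" by simp
    define x where "x = X / Q"
    have x: "x \<ge> 0" "X = x * Q" using X0 Q by (auto simp: x_def)
    \<comment> \<open>This is the goal rewritten with \<open>x = X / Q\<close>. The tangent of
      \<open>excess s\<close> at \<open>x\<close> is nondecreasing for \<open>x \<ge> 1\<close> and
      nonincreasing below, so \<open>le\<close> holds for \<open>hi\<close> and \<open>lo\<close>
      respectively.\<close>
    have main: "excess s x * Q \<le> (\<integral>u. G u * g u \<partial>p)"
      if le: "(1 + s) * (x powr s - 1) * ((\<integral>u. h u * g u \<partial>p) - X) \<ge> 0"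
        and i: "integrable p (\<lambda>u. h u * g u)" and h: "\<And>u. 0 \<le> h u" "\<And>u. excess s (h u) \<le> G u" for h
    proof -
      let ?c = "(1 + s) * (x powr s - 1)"
      have "excess s x * Q \<le> excess s x * Q + ?c * ((\<integral>u. h u * g u \<partial>p) - x * Q)"
        using le x by simp
      also have "\<dots> = (\<integral>u. (excess s x - ?c * x) * g u + ?c * (h u * g u) \<partial>p)"
      proof -
        have "(\<integral>u. (excess s x - ?c * x) * g u + ?c * (h u * g u) \<partial>p)
            = (excess s x - ?c * x) * Q + ?c * (\<integral>u. h u * g u \<partial>p)"
          using i ig unfolding Q_def by (subst Bochner_Integration.integral_add) auto
        then show ?thesis by (simp add: algebra_simps)
      qed
      also have "\<dots> \<le> (\<integral>u. G u * g u \<partial>p)"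
      proof (intro integral_mono iG)
        show "integrable p (\<lambda>u. (excess s x - ?c * x) * g u + ?c * (h u * g u))"
          using i ig by (intro Bochner_Integration.integrable_add integrable_mult_right) 
        fix u
        have "(excess s x + ?c * (h u - x)) * g u \<le> G u * g u"
          using excess_tangent[OF s x(1) h(1)[of u]] h(2)[of u] g(1)[of u]
          by (intro mult_right_mono) auto
        then show "(excess s x - ?c * x) * g u + ?c * (h u * g u) \<le> G u * g u"
          by (simp add: algebra_simps)
      qed
      finally show ?thesis .
    qed
    have "excess s x * Q \<le> (\<integral>u. G u * g u \<partial>p)"
    proof (cases "x \<ge> 1")
      case True
      then have "x powr s \<ge> 1" using s by (simp add: ge_one_powr_ge_zero)
      then show ?thesis using s X ihi G hi by (intro main[of hi]) (auto intro: order_trans[of 0 1])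
    next
      case False
      then have "x powr s \<le> 1" using s x powr_mono2[of s x 1] by simp
      then have "(1 + s) * (x powr s - 1) \<le> 0" using s by (intro mult_nonneg_nonpos) auto
      then show ?thesis using X ilo G lo by (intro main[of lo] mult_nonpos_nonpos) auto
    qed
    moreover have "excess s x * Q = Q * x powr (1 + s) + s * Q - (1 + s) * X"
      by (simp add: excess_def x(2) algebra_simps)
    ultimately show ?thesis unfolding x_def[symmetric] by linarith
  qed
qed

section \<open>Composition of one randomized run with the remaining ones\<close>

lemma nn_integral_mixture_count_space:
  fixes p :: "'u pmf" and f :: "'u \<Rightarrow> 'o::countable pmf" and h :: "'u \<Rightarrow> real"
  assumes h: "\<And>u. 0 \<le> h u" "\<And>u. h u \<le> c"
  shows "(\<integral>\<^sup>+x. ennreal (\<integral>u. h u * pmf (f u) x \<partial>p) \<partial>count_space UNIV) = ennreal (\<integral>u. h u \<partial>p)"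
proof -
  have "0 \<le> c" using h order_trans by blast
  have "ennreal (\<integral>u. h u * pmf (f u) x \<partial>p) = (\<integral>\<^sup>+u. ennreal (h u * pmf (f u) x) \<partial>p)" for x
  proof (intro nn_integral_eq_integral[symmetric] integrable_pmf_bounded[where c = c])
    fix u
    have "h u * pmf (f u) x \<le> c * 1"
      using h \<open>0 \<le> c\<close> by (intro mult_mono) (auto simp: pmf_le_1)
    then show "\<bar>h u * pmf (f u) x\<bar> \<le> c" using h by (simp add: abs_mult)
  qed (use h in auto)
  then have "(\<integral>\<^sup>+x. ennreal (\<integral>u. h u * pmf (f u) x \<partial>p) \<partial>count_space UNIV)
      = (\<integral>\<^sup>+x. (\<integral>\<^sup>+u. ennreal (h u * pmf (f u) x) \<partial>p) \<partial>count_space UNIV)"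
    by simp
  also have "\<dots> = (\<integral>\<^sup>+u. (\<integral>\<^sup>+x. ennreal (h u * pmf (f u) x) \<partial>count_space UNIV) \<partial>p)"
    by (intro nn_integral_count_space_nn_integral[symmetric]) auto
  also have "\<dots> = (\<integral>\<^sup>+u. ennreal (h u) \<partial>p)"
    using h by (simp add: ennreal_mult nn_integral_cmult nn_integral_pmf measure_pmf.emeasure_space_1[simplified])
  also have "\<dots> = ennreal (\<integral>u. h u \<partial>p)"
    using h by (intro nn_integral_eq_integral integrable_pmf_bounded[where c = c]) auto
  finally show ?thesis .
qed

text \<open>At an outcome \<open>x\<close> the bound \<open>FF'\<close> is applied with
  \<open>t\<close> rescaled by the inverse likelihood ratio, \<open>t * Q x / X x\<close>; this is
  why it is assumed for all \<open>t\<close>. The term \<open>t powr - s\<close> then picks up the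
  ratio to the power \<open>s\<close>, and its mean under the left run is a moment of order
  \<open>1 + s\<close> under the right run. Noise in \<open>D\<close> is charged in full.\<close>

lemma expectation_bind_tradeoff:
  fixes p :: "'u pmf" and f g :: "'u \<Rightarrow> 'o::countable pmf" and D :: "'u set"
    and F F' :: "'o \<Rightarrow> real" and hi lo G :: "'u \<Rightarrow> real"
  assumes s: "s > 0" and t: "t > 0" and a: "a \<ge> 0" and b: "b \<ge> 0"
    and hi: "\<And>u. 1 \<le> hi u" "\<And>u. hi u \<le> H"
    and lo: "\<And>u. 0 \<le> lo u" "\<And>u. lo u \<le> 1"
    and G: "\<And>u. excess s (hi u) \<le> G u" "\<And>u. excess s (lo u) \<le> G u" "\<And>u. 0 \<le> G u" "\<And>u. G u \<le> K"
    and up: "\<And>x. (\<integral>u. indicator (- D) u * pmf (f u) x \<partial>p) \<le> (\<integral>u. hi u * pmf (g u) x \<partial>p)"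
    and down: "\<And>x. (\<integral>u. lo u * pmf (g u) x \<partial>p) \<le> (\<integral>u. indicator (- D) u * pmf (f u) x \<partial>p)"
    and F: "\<And>x. 0 \<le> F x" "\<And>x. F x \<le> 1" and F': "\<And>x. 0 \<le> F' x" "\<And>x. F' x \<le> 1"
    and FF': "\<And>x t. x \<in> set_pmf (bind_pmf p f) \<Longrightarrow> t > 0 \<Longrightarrow> F x \<le> t * F' x + a * t powr - s + b"
  shows "(\<integral>x. F x \<partial>bind_pmf p f) \<le> t * (\<integral>x. F' x \<partial>bind_pmf p g)
           + a * (1 + (\<integral>u. G u \<partial>p)) * t powr - s + b + measure p D"
proof -
  define X where "X = (\<lambda>x. \<integral>u. indicator (- D) u * pmf (f u) x \<partial>p)"
  define E where "E = (\<lambda>x. \<integral>u. indicator D u * pmf (f u) x \<partial>p)"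
  define Q where "Q = (\<lambda>x. pmf (bind_pmf p g) x)"
  \<comment> \<open>The integrand of the moment of order \<open>1 + s\<close> of the ratio
    \<open>X / Q\<close>. Where \<open>Q\<close> vanishes it is \<open>0\<close>; nothing is lost,
    as \<open>X\<close> vanishes there too (\<open>XQ\<close>).\<close>
  define Y where "Y = (\<lambda>x. Q x * (X x / Q x) powr (1 + s))"
  define EG where "EG = (\<lambda>x. \<integral>u. G u * pmf (g u) x \<partial>p)"
  have X0: "X x \<ge> 0" and E0: "E x \<ge> 0" and Q0: "Q x \<ge> 0" and Y0: "Y x \<ge> 0" and EG0: "EG x \<ge> 0" for x
    using G unfolding X_def E_def Q_def Y_def EG_def
    by (auto intro!: Bochner_Integration.integral_nonneg mult_nonneg_nonneg)
  have ind: "integrable p (\<lambda>u. indicator B u * pmf (f u) x)" for B x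
    by (intro integrable_pmf_bounded[where c = 1]) (auto simp: indicator_def pmf_le_1)
  have split: "pmf (bind_pmf p f) x = X x + E x" for x
  proof -
    have "X x + E x = (\<integral>u. indicator (- D) u * pmf (f u) x + indicator D u * pmf (f u) x \<partial>p)"
      unfolding X_def E_def using ind by simp
    also have "\<dots> = (\<integral>u. pmf (f u) x \<partial>p)"
      by (intro Bochner_Integration.integral_cong) (auto simp: indicator_def)
    finally show ?thesis by (simp add: pmf_bind)
  qed
  have moment: "Y x + s * Q x \<le> (1 + s) * X x + EG x" for x
    unfolding Y_def EG_def Q_def pmf_bind
    by (rule moment_pointwise[OF s _ _ hi lo G])
       (use up down in \<open>auto simp: X_def pmf_le_1\<close>)
  have XQ: "X x = 0" if "Q x = 0" for x
  proof -
    have ig: "integrable p (\<lambda>u. pmf (g u) x)"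
      by (intro integrable_pmf_bounded[where c = 1]) (auto simp: pmf_le_1)
    have "AE u in p. pmf (g u) x = 0"
      using that integral_nonneg_eq_0_iff_AE[OF ig] by (simp add: Q_def pmf_bind)
    then have "(\<integral>u. hi u * pmf (g u) x \<partial>p) = 0"
      by (intro integral_eq_zero_AE) auto
    with up[of x] X0[of x] show ?thesis unfolding X_def by linarith
  qed
  have pw: "pmf (bind_pmf p f) x * F x \<le> t * (Q x * F' x) + a * t powr - s * Y x + b * X x + E x" for x
  proof -
    have EF: "E x * F x \<le> E x" using E0 F by (simp add: mult_left_le)
    have "X x * F x \<le> t * (Q x * F' x) + a * t powr - s * Y x + b * X x"
    proof (cases "X x = 0")
      case True
      then show ?thesis using t a b Q0 F' Y0 by auto
    next
      case False
      then have X: "X x > 0" using X0[of x] by linarith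
      then have Q: "Q x > 0" using XQ[of x] Q0[of x] by (cases "Q x = 0") auto
      have "x \<in> set_pmf (bind_pmf p f)"
        using X E0[of x] split[of x] by (simp add: set_pmf_iff del: set_bind_pmf)
      then have "F x \<le> (t * Q x / X x) * F' x + a * (t * Q x / X x) powr - s + b"
        using X Q t by (intro FF') auto
      then have "X x * F x \<le> X x * ((t * Q x / X x) * F' x + a * (t * Q x / X x) powr - s + b)"
        using X by (intro mult_left_mono) auto
      also have "\<dots> = t * (Q x * F' x) + a * (X x * (t * Q x / X x) powr - s) + b * X x"
        using X by (simp add: field_simps)
      also have "X x * (t * Q x / X x) powr - s = t powr - s * Y x"
        using X Q t by (simp add: Y_def powr_add powr_divide powr_mult powr_minus field_simps)
      finally show ?thesis by (simp add: algebra_simps)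
    qed
    with EF show ?thesis by (simp add: split algebra_simps)
  qed
  let ?S = "\<lambda>h :: 'o \<Rightarrow> real. \<integral>\<^sup>+x. ennreal (h x) \<partial>count_space UNIV"
  have SX: "?S X = ennreal (\<integral>u. indicator (- D) u \<partial>p)" and SE: "?S E = ennreal (measure p D)"
    and SG: "?S EG = ennreal (\<integral>u. G u \<partial>p)" and SQ: "?S Q = 1"
    unfolding X_def E_def EG_def Q_def using G
    by (auto simp: nn_integral_mixture_count_space[where c = 1] nn_integral_mixture_count_space[where c = K]
         nn_integral_pmf measure_pmf.emeasure_space_1[simplified])
  have SX1: "?S X \<le> 1" unfolding SX by simp
  have IG: "0 \<le> (\<integral>u. G u \<partial>p)" using G by (intro Bochner_Integration.integral_nonneg) auto
  have SY: "?S Y \<le> ennreal (1 + (\<integral>u. G u \<partial>p))"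
  proof -
    \<comment> \<open>In \<open>moment\<close>, summed over all outcomes, the linear terms leave
      \<open>s\<close> on the left and at most \<open>1 + s\<close> on the right, because
      \<open>X\<close> has mass at most one. Only \<open>G\<close> is added to
      \<open>1\<close>.\<close>
    have "?S Y + ennreal s = ?S (\<lambda>x. Y x + s * Q x)"
      using SQ s Y0 Q0 by (simp add: ennreal_plus ennreal_mult nn_integral_add nn_integral_cmult)
    also have "\<dots> \<le> ?S (\<lambda>x. (1 + s) * X x + EG x)"
      by (intro nn_integral_mono ennreal_leI moment)
    also have "\<dots> = ennreal (1 + s) * ?S X + ?S EG"
      using s X0 EG0 by (simp add: ennreal_mult nn_integral_add nn_integral_cmult del: ennreal_plus add: ennreal_plus[of "(1 + s) * X _"])
    also have "\<dots> \<le> ennreal (1 + s) * 1 + ?S EG"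
      by (intro add_right_mono mult_left_mono SX1) auto
    also have "\<dots> = ennreal (1 + (\<integral>u. G u \<partial>p)) + ennreal s"
      unfolding SG using IG s by (simp flip: ennreal_plus add: algebra_simps)
    finally show ?thesis by (simp add: add.commute[of _ "ennreal s"])
  qed
  have conv: "ennreal (\<integral>x. h x \<partial>r) = ?S (\<lambda>x. pmf r x * h x)"
    if "\<And>x. 0 \<le> h x" "\<And>x. h x \<le> 1" for h and r :: "'o pmf"
  proof -
    have "ennreal (\<integral>x. h x \<partial>r) = (\<integral>\<^sup>+x. ennreal (h x) \<partial>r)"
      using that by (intro nn_integral_eq_integral[symmetric] integrable_pmf_bounded[where c = 1]) auto
    also have "\<dots> = ?S (\<lambda>x. pmf r x * h x)"
      using that by (simp add: nn_integral_measure_pmf ennreal_mult)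
    finally show ?thesis .
  qed
  have IF': "0 \<le> (\<integral>x. F' x \<partial>bind_pmf p g)" using F' by (intro Bochner_Integration.integral_nonneg) auto
  have "ennreal (\<integral>x. F x \<partial>bind_pmf p f) = ?S (\<lambda>x. pmf (bind_pmf p f) x * F x)"
    using F by (rule conv)
  also have "\<dots> \<le> ?S (\<lambda>x. t * (Q x * F' x) + a * t powr - s * Y x + b * X x + E x)"
    by (intro nn_integral_mono ennreal_leI pw)
  also have "\<dots> = (\<integral>\<^sup>+x. ennreal t * ennreal (Q x * F' x) + ennreal (a * t powr - s) * ennreal (Y x)
      + ennreal b * ennreal (X x) + ennreal (E x) \<partial>count_space UNIV)"
    using t a b Q0 F' Y0 X0 E0 by (simp add: ennreal_plus ennreal_mult)
  also have "\<dots> = ennreal t * ?S (\<lambda>x. Q x * F' x) + ennreal (a * t powr - s) * ?S Y + ennreal b * ?S X + ?S E"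
    by (simp add: nn_integral_add nn_integral_cmult)
  also have "\<dots> \<le> ennreal t * ?S (\<lambda>x. Q x * F' x)
      + ennreal (a * t powr - s) * ennreal (1 + (\<integral>u. G u \<partial>p)) + ennreal b * 1 + ?S E"
    by (intro add_mono mult_left_mono SY SX1 order_refl) auto
  also have "?S (\<lambda>x. Q x * F' x) = ennreal (\<integral>x. F' x \<partial>bind_pmf p g)"
    unfolding Q_def using F' by (rule conv[symmetric])
  also have "ennreal t * ennreal (\<integral>x. F' x \<partial>bind_pmf p g)
      + ennreal (a * t powr - s) * ennreal (1 + (\<integral>u. G u \<partial>p)) + ennreal b * 1 + ?S E
    = ennreal (t * (\<integral>x. F' x \<partial>bind_pmf p g) + a * (1 + (\<integral>u. G u \<partial>p)) * t powr - s + b + measure p D)"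
    unfolding SE using t a b IF' IG
    by (simp add: ennreal_plus ennreal_mult del: ennreal_plus flip: ennreal_plus ennreal_mult add: algebra_simps)
  finally show ?thesis
    using t a b IF' IG by (subst (asm) ennreal_le_iff) (auto intro!: add_nonneg_nonneg mult_nonneg_nonneg)
qed

text \<open>Both expectations are sums over noise values, and the right one may be reindexed by
  \<open>\<sigma>\<close>; noise \<open>u\<close> in one run is thus compared with
  \<open>\<sigma> u\<close> in the other.\<close>

lemma integral_pmf_le_shift:
  fixes p :: "'u pmf" and h h' :: "'u \<Rightarrow> real"
  assumes "bij \<sigma>" and h: "\<And>u. 0 \<le> h u" "\<And>u. h u \<le> c" and h': "\<And>u. 0 \<le> h' u" "\<And>u. h' u \<le> c'"
    and le: "\<And>u. pmf p u * h u \<le> pmf p (\<sigma> u) * h' (\<sigma> u)"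
  shows "(\<integral>u. h u \<partial>p) \<le> (\<integral>u. h' u \<partial>p)"
proof -
  have "ennreal (\<integral>u. h u \<partial>p) = (\<integral>\<^sup>+u. ennreal (h u) \<partial>p)"
    using h by (intro nn_integral_eq_integral[symmetric] integrable_pmf_bounded[where c = c]) auto
  also have "\<dots> = (\<integral>\<^sup>+u. ennreal (pmf p u * h u) \<partial>count_space UNIV)"
    using h by (simp add: nn_integral_measure_pmf ennreal_mult)
  also have "\<dots> \<le> (\<integral>\<^sup>+u. ennreal (pmf p (\<sigma> u) * h' (\<sigma> u)) \<partial>count_space UNIV)"
    by (intro nn_integral_mono ennreal_leI le)
  also have "\<dots> = (\<integral>\<^sup>+u. ennreal (pmf p u * h' u) \<partial>count_space UNIV)"
    using assms(1) by (rule nn_integral_bij_count_space)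
  also have "\<dots> = (\<integral>\<^sup>+u. ennreal (h' u) \<partial>p)"
    using h' by (simp add: nn_integral_measure_pmf ennreal_mult)
  also have "\<dots> = ennreal (\<integral>u. h' u \<partial>p)"
    using h' by (intro nn_integral_eq_integral integrable_pmf_bounded[where c = c']) auto
  finally show ?thesis
    using h' by (subst (asm) ennreal_le_iff) (auto intro!: Bochner_Integration.integral_nonneg)
qed

section \<open>Discrete Laplace noise on shrinking intervals\<close>

text \<open>The nonnegative integers alone contribute the geometric sum
  \<open>1 / (1 - exp (- lam))\<close>. This supplies the factor \<open>lam\<close> in the bound on
  point masses.\<close>

lemma dlap_norm_ge:
  assumes "lam > 0"
  shows "1 / lam \<le> dlap_norm lam"
proof -
  let ?r = "exp (- lam)"
  have r: "0 < ?r" "?r < 1" using assms by auto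
  have "(\<Sum>n<m. ?r ^ n) \<le> dlap_norm lam" for m
  proof -
    have "(\<Sum>n<m. ?r ^ n) = (\<Sum>z\<in>int ` {..<m}. exp (- lam * \<bar>real_of_int z\<bar>))"
      by (subst sum.reindex) (auto simp: exp_of_nat_mult[symmetric] mult.commute)
    also have "\<dots> \<le> dlap_norm lam"
      unfolding dlap_norm_def by (rule finite_sum_le_infsum[OF dlap_summable[OF assms]]) auto
    finally show ?thesis .
  qed
  then have "(\<Sum>n. ?r ^ n) \<le> dlap_norm lam"
    using r by (intro suminf_le_const summable_geometric) auto
  then have "1 / (1 - ?r) \<le> dlap_norm lam"
    using r by (simp add: suminf_geometric)
  moreover have "1 - ?r \<le> lam" using exp_ge_add_one_self[of "- lam"] by linarith
  then have "1 / lam \<le> 1 / (1 - ?r)" using r by (intro divide_left_mono) auto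
  ultimately show ?thesis by linarith
qed

lemma dlap_norm_pos: "lam > 0 \<Longrightarrow> dlap_norm lam > 0"
  using dlap_norm_ge[of lam] by (smt (verit) divide_pos_pos)

lemma pmf_dlap_le:
  assumes "lam > 0"
  shows "pmf (dlap lam 0) v \<le> lam * exp (lam * v)"
proof -
  have "pmf (dlap lam 0) v \<le> exp (lam * v) / dlap_norm lam"
    using assms dlap_norm_pos[OF assms] mult_left_mono[of "- \<bar>v\<bar>" v lam]
    by (simp add: pmf_dlap divide_right_mono)
  also have "\<dots> \<le> exp (lam * v) / (1 / lam)"
    using assms dlap_norm_ge[OF assms] dlap_norm_pos[OF assms] by (intro divide_left_mono) auto
  finally show ?thesis by (simp add: mult.commute)
qed

lemma pmf_dlap_shift:
  assumes "lam > 0" "\<bar>(v - t) - (v' - t')\<bar> \<le> c"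
  shows "pmf (dlap lam t) v \<le> exp (lam * c) * pmf (dlap lam t') v'"
proof -
  have "\<bar>v' - t'\<bar> \<le> \<bar>v - t\<bar> + c" using assms(2) by linarith
  then have "\<bar>real_of_int (v' - t')\<bar> \<le> \<bar>real_of_int (v - t)\<bar> + c" by linarith
  then have "lam * \<bar>real_of_int (v' - t')\<bar> \<le> lam * (\<bar>real_of_int (v - t)\<bar> + c)"
    using assms by (intro mult_left_mono) auto
  then have "exp (- lam * \<bar>real_of_int (v - t)\<bar>) \<le> exp (lam * c + - lam * \<bar>real_of_int (v' - t')\<bar>)"
    by (simp add: algebra_simps)
  then have "exp (- lam * \<bar>real_of_int (v - t)\<bar>) \<le> exp (lam * c) * exp (- lam * \<bar>real_of_int (v' - t')\<bar>)"
    by (simp only: exp_add)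
  from divide_right_mono[OF this, of "dlap_norm lam"] show ?thesis
    using dlap_norm_pos[OF assms(1)] by (simp add: pmf_dlap assms(1))
qed

section \<open>Mass of nested integer intervals\<close>

lemma sum_open_interval_left:
  fixes f :: "int \<Rightarrow> real"
  assumes "a + 1 < b"
  shows "sum f {a<..<b} = f (a + 1) + sum f {a+1<..<b}"
proof -
  have "{a<..<b} = insert (a + 1) {a+1<..<b}" using assms by auto
  moreover have "sum f (insert (a + 1) {a+1<..<b}) = f (a + 1) + sum f {a+1<..<b}"
    by (rule sum.insert) auto
  ultimately show ?thesis by metis
qed

lemma sum_open_interval_right:
  fixes f :: "int \<Rightarrow> real"
  assumes "a + 1 < b"
  shows "sum f {a<..<b} = sum f {a<..<b-1} + f (b - 1)"
proof -
  have "{a<..<b} = insert (b - 1) {a<..<b-1}" using assms by auto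
  moreover have "sum f (insert (b - 1) {a<..<b-1}) = f (b - 1) + sum f {a<..<b-1}"
    by (rule sum.insert) auto
  ultimately show ?thesis by (metis add.commute)
qed

text \<open>Uniform mass on the outer interval can be carried to the inner one by steps of at most
  one, so the average of \<open>w\<close> drops by a factor of at most \<open>c\<close>; the
  prefactors are the two point counts, placed crosswise.\<close>

lemma sum_interval_shrink:
  fixes w :: "int \<Rightarrow> real" and a b :: int
  assumes ab: "a + 4 \<le> b" and w: "\<And>v v'. \<bar>v - v'\<bar> \<le> 1 \<Longrightarrow> w v \<le> c * w v'"
  shows "real_of_int (b - a - 3) * (\<Sum>v\<in>{a<..<b}. w v) \<le> real_of_int (b - a - 1) * c * (\<Sum>v\<in>{a+1<..<b-1}. w v)"
proof -
  let ?I = "{a<..<b}" and ?J = "{a+1<..<b-1}"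
  \<comment> \<open>Reindexing gives a sum up to \<open>b - 3\<close>; extending it to
    \<open>?I\<close> adds weight \<open>0\<close> at \<open>b - 2\<close> and \<open>-1\<close> at
    \<open>b - 1\<close>. The corrections here and in \<open>r\<close> cancel against those in
    \<open>m\<close>.\<close>
  have l: "(\<Sum>v\<in>?J. real_of_int (b - 1 - v) * w (v - 1)) = (\<Sum>v\<in>?I. real_of_int (b - 2 - v) * w v) + w (b - 1)"
  proof -
    have "(\<Sum>v\<in>?J. real_of_int (b - 1 - v) * w (v - 1)) = (\<Sum>v\<in>{a<..<b-2}. real_of_int (b - 2 - v) * w v)"
      by (rule sum.reindex_bij_witness[of _ "\<lambda>v. v + 1" "\<lambda>v. v - 1"]) auto
    moreover have "(\<Sum>v\<in>{a<..<b-1}. real_of_int (b - 2 - v) * w v) = (\<Sum>v\<in>{a<..<b-2}. real_of_int (b - 2 - v) * w v)"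
      using ab by (subst sum_open_interval_right) auto
    moreover have "(\<Sum>v\<in>?I. real_of_int (b - 2 - v) * w v) = (\<Sum>v\<in>{a<..<b-1}. real_of_int (b - 2 - v) * w v) - w (b - 1)"
      using ab by (subst sum_open_interval_right) auto
    ultimately show ?thesis by linarith
  qed
  have r: "(\<Sum>v\<in>?J. real_of_int (v - a - 1) * w (v + 1)) = (\<Sum>v\<in>?I. real_of_int (v - a - 2) * w v) + w (a + 1)"
  proof -
    have "(\<Sum>v\<in>?J. real_of_int (v - a - 1) * w (v + 1)) = (\<Sum>v\<in>{a+2<..<b}. real_of_int (v - a - 2) * w v)"
      by (rule sum.reindex_bij_witness[of _ "\<lambda>v. v - 1" "\<lambda>v. v + 1"]) auto
    moreover have "(\<Sum>v\<in>{a+1<..<b}. real_of_int (v - a - 2) * w v) = (\<Sum>v\<in>{a+2<..<b}. real_of_int (v - a - 2) * w v)"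
      using ab by (subst sum_open_interval_left) (auto simp: add.commute[of a])
    moreover have "(\<Sum>v\<in>?I. real_of_int (v - a - 2) * w v) = (\<Sum>v\<in>{a+1<..<b}. real_of_int (v - a - 2) * w v) - w (a + 1)"
      using ab by (subst sum_open_interval_left) auto
    ultimately show ?thesis by linarith
  qed
  have m: "(\<Sum>v\<in>?J. w v) = (\<Sum>v\<in>?I. w v) - w (a + 1) - w (b - 1)"
    using ab sum_open_interval_left[of a b w] sum_open_interval_right[of "a + 1" b w] by linarith
  \<comment> \<open>transports uniform mass on \<open>?I\<close> to uniform mass on \<open>?J\<close>, moving each point by at most one\<close>
  have "real_of_int (b - a - 3) * (\<Sum>v\<in>?I. w v)
      = (\<Sum>v\<in>?I. real_of_int (b - 2 - v) * w v + real_of_int (v - a - 2) * w v + w v)"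
    unfolding sum_distrib_left by (intro sum.cong refl) (simp add: algebra_simps)
  also have "\<dots> = (\<Sum>v\<in>?J. real_of_int (b - 1 - v) * w (v - 1) + w v + real_of_int (v - a - 1) * w (v + 1))"
    unfolding sum.distrib l r m by simp
  also have "\<dots> \<le> (\<Sum>v\<in>?J. real_of_int (b - 1 - v) * (c * w v) + c * w v + real_of_int (v - a - 1) * (c * w v))"
  proof (intro sum_mono add_mono)
    fix v assume v: "v \<in> ?J"
    show "real_of_int (b - 1 - v) * w (v - 1) \<le> real_of_int (b - 1 - v) * (c * w v)"
      using v by (intro mult_left_mono w) auto
    show "w v \<le> c * w v" by (rule w) simp
    show "real_of_int (v - a - 1) * w (v + 1) \<le> real_of_int (v - a - 1) * (c * w v)"
      using v by (intro mult_left_mono w) auto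
  qed
  also have "\<dots> = real_of_int (b - a - 1) * c * (\<Sum>v\<in>?J. w v)"
    unfolding sum_distrib_left by (intro sum.cong refl) (simp add: algebra_simps)
  finally show ?thesis .
qed

text \<open>One factor \<open>exp lam\<close> pays for the transport between the intervals, a second
  one for moving the centre from \<open>t\<close> to \<open>t'\<close>.\<close>

lemma dlap_interval_shrink:
  fixes t t' :: int
  assumes lam: "lam > 0" and t: "\<bar>t - t'\<bar> \<le> 1" and ab: "a + 4 \<le> b"
  shows "measure (dlap lam t) {a<..<b}
    \<le> exp (2 * lam) * (real_of_int (b - a - 1) / real_of_int (b - a - 3)) * measure (dlap lam t') {a+1<..<b-1}"
proof -
  have "real_of_int (b - a - 3) * (\<Sum>v\<in>{a<..<b}. pmf (dlap lam t) v)
      \<le> real_of_int (b - a - 1) * exp lam * (\<Sum>v\<in>{a+1<..<b-1}. pmf (dlap lam t) v)"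
  proof (rule sum_interval_shrink[OF ab])
    fix v v' :: int assume "\<bar>v - v'\<bar> \<le> 1"
    then show "pmf (dlap lam t) v \<le> exp lam * pmf (dlap lam t) v'"
      using pmf_dlap_shift[OF lam, of v t v' t 1] by simp
  qed
  also have "\<dots> \<le> real_of_int (b - a - 1) * exp lam * (\<Sum>v\<in>{a+1<..<b-1}. exp lam * pmf (dlap lam t') v)"
  proof (intro mult_left_mono sum_mono)
    fix v
    show "pmf (dlap lam t) v \<le> exp lam * pmf (dlap lam t') v"
      using t pmf_dlap_shift[OF lam, of v t v t' 1] by (simp add: abs_minus_commute)
  qed (use ab in auto)
  also have "\<dots> = real_of_int (b - a - 1) * exp (2 * lam) * (\<Sum>v\<in>{a+1<..<b-1}. pmf (dlap lam t') v)"
  proof -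
    have "exp (2 * lam) = exp lam * exp lam" by (simp flip: exp_add)
    then show ?thesis unfolding sum_distrib_left[symmetric] by (simp only: mult_ac)
  qed
  finally have "real_of_int (b - a - 3) * measure (dlap lam t) {a<..<b}
      \<le> real_of_int (b - a - 1) * exp (2 * lam) * measure (dlap lam t') {a+1<..<b-1}"
    by (simp only: measure_measure_pmf_finite finite_greaterThanLessThan_int)
  moreover have "0 < real_of_int (b - a - 3)" using ab by simp
  ultimately show ?thesis
    by (simp only: pos_le_divide_eq[symmetric] mult.commute[of "real_of_int (b - a - 3)"])
       (simp only: times_divide_eq_left times_divide_eq_right mult_ac)
qed

text \<open>Translation by \<open>t - t'\<close> carries the inner interval into the outer one.
  Hence a miss on \<open>d\<close> is no more likely than a miss of the shrunk interval on
  \<open>d'\<close>: misses cost nothing, however many precede a hit.\<close>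

lemma dlap_interval_mono:
  fixes t t' :: int
  assumes lam: "lam > 0" and t: "\<bar>t - t'\<bar> \<le> 1"
  shows "measure (dlap lam t') {a+1<..<b-1} \<le> measure (dlap lam t) {a<..<b}"
proof -
  have "(\<Sum>v\<in>{a+1<..<b-1}. pmf (dlap lam t') v) = (\<Sum>v\<in>{a+1<..<b-1}. pmf (dlap lam t) (v + (t - t')))"
    using lam by (simp add: pmf_dlap)
  also have "\<dots> = (\<Sum>v\<in>(\<lambda>v. v + (t - t')) ` {a+1<..<b-1}. pmf (dlap lam t) v)"
    by (subst sum.reindex) (auto simp: inj_on_def)
  also have "\<dots> \<le> (\<Sum>v\<in>{a<..<b}. pmf (dlap lam t) v)"
    using t by (intro sum_mono2) auto
  finally show ?thesis by (simp add: measure_measure_pmf_finite)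
qed

section \<open>The likelihood ratio of a run of the inner loop\<close>

lemma bt_inner_exhausted: "N < i \<Longrightarrow> bt_inner \<epsilon>' N q d a b i True out = return_pmf (i, out)"
  by (subst bt_inner.simps) simp

text \<open>Only whether \<open>v\<close> hits the interval matters, so the loop body is a mixture
  of two branches. The hit branch ends at \<open>i + 1\<close> because the index is increased before
  the loop is left.\<close>

lemma pmf_bt_inner_unfold:
  fixes q :: "nat \<Rightarrow> 'd \<Rightarrow> int" and d :: 'd and a b :: int and \<epsilon>' :: real
  assumes "i \<le> N"
  defines "h \<equiv> measure (dlap (\<epsilon>' / 3) (q i d)) {a<..<b}"
  shows "pmf (bt_inner \<epsilon>' N q d a b i True out) x
    = h * pmf (map_pmf (\<lambda>noisy. (i + 1, (i, noisy) # out)) (dlap \<epsilon>' (q i d))) x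
      + (1 - h) * pmf (bt_inner \<epsilon>' N q d a b (i + 1) True out) x"
proof -
  let ?p = "dlap (\<epsilon>' / 3) (q i d)" and ?I = "{a<..<b}"
  let ?hit = "map_pmf (\<lambda>noisy. (i + 1, (i, noisy) # out)) (dlap \<epsilon>' (q i d))"
  let ?next = "bt_inner \<epsilon>' N q d a b (i + 1) True out"
  have stop: "bt_inner \<epsilon>' N q d a b j False out' = return_pmf (j, out')" for j out'
    by (subst bt_inner.simps) simp
  have "bt_inner \<epsilon>' N q d a b i True out = bind_pmf ?p (\<lambda>v. if v \<in> ?I then ?hit else ?next)"
    using assms(1) by (subst bt_inner.simps)
      (auto simp: bind_assoc_pmf bind_return_pmf stop map_pmf_def intro!: bind_pmf_cong)
  then have "pmf (bt_inner \<epsilon>' N q d a b i True out) x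
      = (\<integral>v. pmf (if v \<in> ?I then ?hit else ?next) x \<partial>?p)"
    by (simp add: pmf_bind)
  also have "\<dots> = (\<integral>v. pmf ?next x + indicator ?I v * (pmf ?hit x - pmf ?next x) \<partial>?p)"
    by (intro Bochner_Integration.integral_cong) (auto simp: indicator_def)
  also have "\<dots> = pmf ?next x + h * (pmf ?hit x - pmf ?next x)"
    by (subst Bochner_Integration.integral_add)
       (auto simp: h_def intro!: integrable_pmf_bounded[where c = 1])
  also have "\<dots> = h * pmf ?hit x + (1 - h) * pmf ?next x"
    by (simp add: algebra_simps)
  finally show ?thesis .
qed

text \<open>A hit ends the run, so \<open>\<rho>\<close> and the factor
  \<open>exp \<epsilon>'\<close> for the noisy answer are paid at most once; misses are free by
  \<open>dlap_interval_mono\<close>.\<close>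

lemma pmf_bt_inner_shrink:
  assumes \<epsilon>': "\<epsilon>' > 0" and q: "\<And>i. i \<in> {1..N} \<Longrightarrow> \<bar>q i d - q i d'\<bar> \<le> 1"
    and \<rho>: "\<rho> \<ge> 1" "\<And>t t'. \<bar>t - t'\<bar> \<le> 1 \<Longrightarrow>
      measure (dlap (\<epsilon>' / 3) t) {a<..<b} \<le> \<rho> * measure (dlap (\<epsilon>' / 3) t') {a+1<..<b-1}"
    and i: "1 \<le> i"
  shows "pmf (bt_inner \<epsilon>' N q d a b i True out) x
    \<le> exp \<epsilon>' * \<rho> * pmf (bt_inner \<epsilon>' N q d' (a + 1) (b - 1) i True out) x"
  using i
proof (induction "N + 1 - i" arbitrary: i)
  case 0
  then have "N < i" by simp
  moreover have "1 \<le> exp \<epsilon>' * \<rho>" using \<epsilon>' \<rho>(1) mult_mono[of 1 "exp \<epsilon>'" 1 \<rho>] by simp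
  ultimately show ?case by (simp add: bt_inner_exhausted indicator_def)
next
  case (Suc n)
  have iN: "i \<le> N" using Suc.hyps(2) by linarith
  have qi: "\<bar>q i d - q i d'\<bar> \<le> 1" using iN Suc.prems by (intro q) auto
  let ?p = "dlap (\<epsilon>' / 3) (q i d)" and ?p' = "dlap (\<epsilon>' / 3) (q i d')"
  let ?f = "\<lambda>noisy. (i + 1, (i, noisy) # out)"
  let ?h = "measure ?p {a<..<b}" and ?h' = "measure ?p' {a+1<..<b-1}"
  have noisy: "pmf (map_pmf ?f (dlap \<epsilon>' (q i d))) x \<le> exp \<epsilon>' * pmf (map_pmf ?f (dlap \<epsilon>' (q i d'))) x"
  proof (cases "x \<in> range ?f")
    case True
    then obtain y where y: "x = ?f y" by blast
    have inj: "inj ?f" by (auto simp: inj_def)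
    show ?thesis
      using pmf_dlap_shift[OF \<epsilon>', of y "q i d" y "q i d'" 1] qi
      by (simp only: y pmf_map_inj'[OF inj]) (simp add: abs_minus_commute)
  next
    case False
    then have "x \<notin> ?f ` set_pmf (dlap \<epsilon>' (q i d))" by blast
    then show ?thesis by (simp add: pmf_map_outside)
  qed
  have hit: "?h * pmf (map_pmf ?f (dlap \<epsilon>' (q i d))) x
      \<le> (\<rho> * ?h') * (exp \<epsilon>' * pmf (map_pmf ?f (dlap \<epsilon>' (q i d'))) x)"
    using \<rho> qi noisy by (intro mult_mono) auto
  have miss: "(1 - ?h) * pmf (bt_inner \<epsilon>' N q d a b (i + 1) True out) x
      \<le> (1 - ?h') * (exp \<epsilon>' * \<rho> * pmf (bt_inner \<epsilon>' N q d' (a + 1) (b - 1) (i + 1) True out) x)"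
    using Suc.hyps(2) \<epsilon>' qi dlap_interval_mono[of "\<epsilon>' / 3" "q i d" "q i d'" a b]
    by (intro mult_mono Suc.hyps(1)) auto
  show ?case
    using hit miss by (simp add: pmf_bt_inner_unfold[OF iN] algebra_simps)
qed

text \<open>A run that leaves queries unread has produced an output, so the number of outputs still
  to come can serve as the exponent in the composition.\<close>

lemma bt_inner_outcome:
  assumes "r \<in> set_pmf (bt_inner \<epsilon>' N q d a b i True out)"
  shows "fst r > N \<or> length (snd r) = Suc (length out)"
  using assms
proof (induction "N + 1 - i" arbitrary: i)
  case 0
  then have "N < i" by simp
  then show ?case using 0 by (simp add: bt_inner_exhausted)
next
  case (Suc n)
  have iN: "i \<le> N" using Suc.hyps(2) by linarith
  have "pmf (bt_inner \<epsilon>' N q d a b i True out) r \<noteq> 0" using Suc.prems by (simp add: set_pmf_iff)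
  then have "pmf (map_pmf (\<lambda>noisy. (i + 1, (i, noisy) # out)) (dlap \<epsilon>' (q i d))) r \<noteq> 0
      \<or> pmf (bt_inner \<epsilon>' N q d a b (i + 1) True out) r \<noteq> 0"
    by (subst (asm) pmf_bt_inner_unfold[OF iN]) (metis add.right_neutral mult_zero_right)
  then consider "r \<in> set_pmf (map_pmf (\<lambda>noisy. (i + 1, (i, noisy) # out)) (dlap \<epsilon>' (q i d)))"
    | "r \<in> set_pmf (bt_inner \<epsilon>' N q d a b (i + 1) True out)"
    by (auto simp only: set_pmf_iff)
  then show ?case
  proof cases
    case 2
    moreover have "n = N + 1 - (i + 1)" using Suc.hyps(2) by linarith
    ultimately show ?thesis by (intro Suc.hyps(1)[of "i + 1"])
  qed auto
qed

section \<open>Classification of the threshold noise by the width of the interval\<close>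

lemma sum_inverse_squares_le:
  fixes m n :: int
  assumes "1 \<le> m"
  shows "(\<Sum>j\<in>{m<..n}. 1 / (real_of_int j)\<^sup>2) \<le> 1 / m"
proof (cases "m \<le> n")
  case True
  then have "(\<Sum>j\<in>{m<..n}. 1 / (real_of_int j)\<^sup>2) \<le> 1 / m - 1 / n"
  proof (induction n rule: int_ge_induct)
    case base
    then show ?case by simp
  next
    case (step k)
    have k: "real_of_int k \<ge> 1" using step assms by linarith
    have "{m<..k+1} = insert (k + 1) {m<..k}" using step by auto
    then have "(\<Sum>j\<in>{m<..k+1}. 1 / (real_of_int j)\<^sup>2) = 1 / (real_of_int k + 1)\<^sup>2 + (\<Sum>j\<in>{m<..k}. 1 / (real_of_int j)\<^sup>2)"
      by simp
    also have "\<dots> \<le> 1 / (real_of_int k + 1)\<^sup>2 + (1 / m - 1 / k)" using step by simp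
    also have "1 / (real_of_int k + 1)\<^sup>2 \<le> 1 / (real_of_int k * (real_of_int k + 1))"
      using k by (intro divide_left_mono) (auto simp: power2_eq_square)
    also have "1 / (real_of_int k * (real_of_int k + 1)) = 1 / k - 1 / (k + 1)"
      using k by (simp add: field_simps)
    finally show ?case by simp
  qed
  moreover have "1 / real_of_int n \<ge> 0" using True assms by simp
  ultimately show ?thesis by linarith
next
  case False
  then show ?thesis using assms by simp
qed

text \<open>\<open>\<pi>\<close> bounds the point masses of the threshold noise wherever the width
  is too small for a loss of \<open>3 * \<epsilon>'\<close>. The slack \<open>6\<close> lets it
  cover \<open>narrow\<close>, which reaches \<open>6\<close> beyond the cutoff.\<close>

locale noisy_thresholds =
  fixes \<epsilon>' s \<pi> :: real and A B :: int
  assumes \<epsilon>': "0 < \<epsilon>'" and s: "2 \<le> s"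
    and pmf_narrow: "\<And>u. real_of_int (B - A + 2 * u - 1) \<le> 6 / \<epsilon>' + 6 \<Longrightarrow> pmf (dlap \<epsilon>' 0) u \<le> \<pi>"
begin

text \<open>\<open>width u\<close> counts the integers strictly between the noisy thresholds \<open>A - u\<close> and \<open>B + u\<close>
  (if nonnegative).\<close>

definition width :: "int \<Rightarrow> int" where "width u = B - A + 2 * u - 1"

text \<open>With \<open>j = width u - 2\<close>: from \<open>j = 6 / \<epsilon>'\<close> on,
  \<open>2 / j\<close> is at most \<open>\<epsilon>' / 3\<close>; from
  \<open>j = 18 * (1 + s)\<close> on, a loss of \<open>18 / j\<close> times \<open>1 + s\<close> is
  at most one, which permits a quadratic expansion. If \<open>6 / \<epsilon>'\<close> is the
  minimum, \<open>intermediate\<close> is empty.\<close>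

definition cutoff :: real where "cutoff = min (18 * (1 + s)) (6 / \<epsilon>')"

text \<open>Noise in \<open>discarded\<close> is charged to \<open>\<delta>\<close>. The set \<open>narrow\<close> contains it and its shift by one;
  there the lower bound on the likelihood ratio is lost.\<close>

definition discarded :: "int set" where
  "discarded = {u. 1 \<le> width u \<and> width u \<le> cutoff + 4}"

definition narrow :: "int set" where
  "narrow = {u. 1 \<le> width u \<and> width u \<le> cutoff + 6}"

definition intermediate :: "int set" where
  "intermediate = {u. 18 * (1 + s) < width u - 2 \<and> width u - 2 < 6 / \<epsilon>'}"

text \<open>\<open>2 / (width u - 2)\<close> bounds both \<open>ln (k / (k - 2))\<close> for \<open>k = width u\<close>, needed for the lower bound, and
  \<open>ln ((k + 2) / k)\<close>, needed for the upper bound after reindexing by the shift.\<close>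

definition loss :: "int \<Rightarrow> real" where
  "loss u = 8 / 3 * \<epsilon>' + (if cutoff + 2 < width u then 2 / (width u - 2) else 0)"

text \<open>The first term belongs to losses up to \<open>3 * \<epsilon>'\<close>, the second to the
  losses \<open>18 / (width u - 2)\<close>. On \<open>narrow\<close> the lower ratio is replaced by
  \<open>0\<close>, and \<open>excess s 0 = s\<close>.\<close>

definition moment_gain :: "int \<Rightarrow> real" where
  "moment_gain u = exp (((1 + s) * (3 * \<epsilon>'))\<^sup>2) - 1
     + (if u \<in> intermediate then 648 * (1 + s)\<^sup>2 / (real_of_int (width u - 2))\<^sup>2 else 0)
     + (if u \<in> narrow then s else 0)"

text \<open>The \<open>\<Phi>\<close> of the overview, bounding one plus the mean of
  \<open>moment_gain\<close>: \<open>18 * (1 + s) - 1\<close> stems from the tail of the inverse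
  squares, \<open>18 * (1 + s) + 6\<close> from counting \<open>narrow\<close>.\<close>

definition round_growth :: real where
  "round_growth = exp (((1 + s) * (3 * \<epsilon>'))\<^sup>2) + \<pi> * (648 * (1 + s)\<^sup>2 / (18 * (1 + s) - 1) + s * (18 * (1 + s) + 6))"

lemma cutoff_bounds: "0 < cutoff" "cutoff \<le> 18 * (1 + s)" "cutoff \<le> 6 / \<epsilon>'"
  using \<epsilon>' s by (auto simp: cutoff_def)

lemma width_shift: "width (u - 1) = width u - 2"
  by (simp add: width_def)

lemma inj_width: "inj_on width S"
  by (auto simp: inj_on_def width_def)

lemma pi_nonneg: "0 \<le> \<pi>"
proof -
  \<comment> \<open>A witness of negative width, to which \<open>pmf_narrow\<close> certainly
    applies.\<close>
  define u where "u = min 0 (A - B)"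
  have "u \<le> 0" "u \<le> A - B" by (simp_all add: u_def)
  then have "B - A + 2 * u - 1 \<le> 0" by linarith
  then have "real_of_int (B - A + 2 * u - 1) \<le> 0" by linarith
  also have "\<dots> \<le> 6 / \<epsilon>' + 6" using \<epsilon>' by simp
  finally show ?thesis using pmf_narrow[of u] pmf_nonneg[of "dlap \<epsilon>' 0" u] by linarith
qed

lemma pmf_le_pi: "width u \<le> 6 / \<epsilon>' + 6 \<Longrightarrow> pmf (dlap \<epsilon>' 0) u \<le> \<pi>"
  using pmf_narrow by (simp add: width_def)

lemma loss_nonneg: "0 \<le> loss u"
  using \<epsilon>' cutoff_bounds by (auto simp: loss_def)

lemma loss_cases: "loss u \<le> 3 * \<epsilon>' \<or> u \<in> intermediate \<and> loss u \<le> 18 / (width u - 2)"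
proof -
  consider "width u \<le> cutoff + 2" | "cutoff + 2 < width u" "6 / \<epsilon>' \<le> width u - 2" | "cutoff + 2 < width u" "width u - 2 < 6 / \<epsilon>'"
    by linarith
  then show ?thesis
  proof cases
    case 1
    then show ?thesis using \<epsilon>' by (simp add: loss_def)
  next
    case 2
    have "2 / real_of_int (width u - 2) \<le> 2 / (6 / \<epsilon>')" using 2 \<epsilon>' cutoff_bounds by (intro divide_left_mono) auto
    then show ?thesis using 2 by (simp add: loss_def)
  next
    case 3
    let ?j = "real_of_int (width u - 2)"
    have j: "?j > 0" using 3 cutoff_bounds by simp
    have "\<epsilon>' < 6 / ?j" using 3 j \<epsilon>' by (simp add: field_simps)
    \<comment> \<open>The constant \<open>18\<close> is \<open>8 / 3 * 6 + 2\<close>.\<close>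
    then have "8 / 3 * \<epsilon>' + 2 / ?j \<le> 18 / ?j" by (simp add: field_simps)
    moreover have "18 * (1 + s) < ?j" using 3 by (auto simp: cutoff_def)
    ultimately show ?thesis using 3 by (simp add: loss_def intermediate_def)
  qed
qed

lemma moment_gain_nonneg: "0 \<le> moment_gain u"
  using s by (auto simp: moment_gain_def)

lemma excess_loss_le:
  assumes "\<bar>y\<bar> = loss u"
  shows "excess s (exp y) \<le> moment_gain u"
proof -
  have y2: "((1 + s) * y)\<^sup>2 = ((1 + s) * loss u)\<^sup>2"
    by (metis assms power2_abs power_mult_distrib)
  have ex: "excess s (exp y) \<le> exp (((1 + s) * loss u)\<^sup>2) - 1"
    using excess_exp[of s y] s unfolding y2 by simp
  show ?thesis
  proof (cases "loss u \<le> 3 * \<epsilon>'")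
    case True
    then have "((1 + s) * loss u)\<^sup>2 \<le> ((1 + s) * (3 * \<epsilon>'))\<^sup>2"
      using s loss_nonneg by (intro power_mono mult_left_mono) auto
    then have "excess s (exp y) \<le> exp (((1 + s) * (3 * \<epsilon>'))\<^sup>2) - 1"
      using ex by (smt (verit) exp_le_cancel_iff)
    also have "\<dots> \<le> moment_gain u" using s by (auto simp: moment_gain_def)
    finally show ?thesis .
  next
    case False
    with loss_cases have u: "u \<in> intermediate" and l: "loss u \<le> 18 / (width u - 2)" by blast+
    let ?j = "real_of_int (width u - 2)"
    have j: "18 * (1 + s) < ?j" using u by (simp add: intermediate_def)
    have zl: "(1 + s) * loss u \<le> 18 * (1 + s) / ?j"
      using mult_left_mono[OF l, of "1 + s"] s by (simp add: field_simps)
    also have "\<dots> \<le> 1" using j s by (simp add: field_simps)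
    finally have z1: "((1 + s) * loss u)\<^sup>2 \<le> 1"
      using s loss_nonneg[of u] by (intro power_le_one) auto
    \<comment> \<open>For \<open>0 \<le> z \<le> 1\<close> this yields
      \<open>exp z - 1 \<le> 2 * z\<close>; the \<open>2\<close> and the square of \<open>18\<close>
      make up \<open>648\<close>.\<close>
    then have "exp (((1 + s) * loss u)\<^sup>2) \<le> 1 + ((1 + s) * loss u)\<^sup>2 + (((1 + s) * loss u)\<^sup>2)\<^sup>2"
      by (intro exp_bound) auto
    also have "(((1 + s) * loss u)\<^sup>2)\<^sup>2 \<le> ((1 + s) * loss u)\<^sup>2"
      using z1 mult_left_le[of "((1 + s) * loss u)\<^sup>2" "((1 + s) * loss u)\<^sup>2"]
      by (simp add: power2_eq_square[of "((1 + s) * loss u)\<^sup>2"])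
    finally have "excess s (exp y) \<le> 2 * ((1 + s) * loss u)\<^sup>2" using ex by linarith
    also have "((1 + s) * loss u)\<^sup>2 \<le> (18 * (1 + s) / ?j)\<^sup>2"
      using zl s loss_nonneg[of u] by (intro power_mono) auto
    also have "2 * (18 * (1 + s) / ?j)\<^sup>2 = 648 * (1 + s)\<^sup>2 / ?j\<^sup>2"
      by (simp only: power_divide power_mult_distrib) simp
    also have "\<dots> \<le> moment_gain u" using u s by (auto simp: moment_gain_def)
    finally show ?thesis by simp
  qed
qed

lemma finite_narrow: "finite narrow" and card_narrow_le: "card narrow \<le> 18 * (1 + s) + 6"
proof -
  have sub: "width ` narrow \<subseteq> {1..\<lfloor>cutoff + 6\<rfloor>}" by (auto simp: narrow_def) linarith
  then have "finite (width ` narrow)" by (rule finite_subset) simp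
  then show "finite narrow" using finite_image_iff[OF inj_width] by blast
  have "card narrow = card (width ` narrow)" by (simp add: card_image inj_width)
  also have "\<dots> \<le> card {1..\<lfloor>cutoff + 6\<rfloor>}" using sub by (intro card_mono) auto
  finally have "real (card narrow) \<le> real (nat \<lfloor>cutoff + 6\<rfloor>)" by simp
  also have "\<dots> \<le> cutoff + 6" using cutoff_bounds(1) by simp
  finally show "card narrow \<le> 18 * (1 + s) + 6" using cutoff_bounds(2) by simp
qed

lemma prob_narrow_le: "measure (dlap \<epsilon>' 0) narrow \<le> \<pi> * (18 * (1 + s) + 6)"
proof -
  have "measure (dlap \<epsilon>' 0) narrow = (\<Sum>u\<in>narrow. pmf (dlap \<epsilon>' 0) u)"
    by (rule measure_measure_pmf_finite[OF finite_narrow])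
  also have "\<dots> \<le> (\<Sum>u\<in>narrow. \<pi>)"
    using cutoff_bounds by (intro sum_mono pmf_le_pi) (auto simp: narrow_def)
  also have "\<dots> = \<pi> * card narrow" by simp
  also have "\<dots> \<le> \<pi> * (18 * (1 + s) + 6)" using card_narrow_le pi_nonneg by (intro mult_left_mono)
  finally show ?thesis .
qed

lemma prob_discarded_le: "measure (dlap \<epsilon>' 0) discarded \<le> \<pi> * (18 * (1 + s) + 6)"
proof -
  have "measure (dlap \<epsilon>' 0) discarded \<le> measure (dlap \<epsilon>' 0) narrow"
    by (intro measure_pmf.finite_measure_mono) (auto simp: discarded_def narrow_def)
  with prob_narrow_le show ?thesis by linarith
qed

lemma finite_intermediate: "finite intermediate"
  and sum_intermediate_le: "(\<Sum>u\<in>intermediate. 1 / (real_of_int (width u - 2))\<^sup>2) \<le> 1 / (18 * (1 + s) - 1)"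
proof -
  let ?m = "\<lfloor>18 * (1 + s)\<rfloor>" and ?n = "\<lfloor>6 / \<epsilon>'\<rfloor>"
  have inj: "inj_on (\<lambda>u. width u - 2) intermediate" by (auto simp: inj_on_def width_def)
  have sub: "(\<lambda>u. width u - 2) ` intermediate \<subseteq> {?m<..?n}"
    unfolding intermediate_def by (auto; linarith)
  then have "finite ((\<lambda>u. width u - 2) ` intermediate)" by (rule finite_subset) simp
  then show "finite intermediate" using finite_image_iff[OF inj] by blast
  have "(\<Sum>u\<in>intermediate. 1 / (real_of_int (width u - 2))\<^sup>2)
      = (\<Sum>j\<in>(\<lambda>u. width u - 2) ` intermediate. 1 / (real_of_int j)\<^sup>2)"
    by (simp add: sum.reindex[OF inj])
  also have "\<dots> \<le> (\<Sum>j\<in>{?m<..?n}. 1 / (real_of_int j)\<^sup>2)"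
    using sub by (intro sum_mono2) auto
  also have "\<dots> \<le> 1 / ?m" using s by (intro sum_inverse_squares_le) (simp add: le_floor_iff)
  also have "\<dots> \<le> 1 / (18 * (1 + s) - 1)" 
  proof (intro divide_left_mono mult_pos_pos)
    show "18 * (1 + s) - 1 \<le> ?m" by linarith
    show pos: "0 < 18 * (1 + s) - 1" using s by simp
    show "0 < real_of_int ?m" using pos by linarith
  qed simp
  finally show "(\<Sum>u\<in>intermediate. 1 / (real_of_int (width u - 2))\<^sup>2) \<le> 1 / (18 * (1 + s) - 1)" .
qed

lemma moment_gain_le: "moment_gain u \<le> exp (((1 + s) * (3 * \<epsilon>'))\<^sup>2) + 648 * (1 + s)\<^sup>2 + s"
proof -
  have "648 * (1 + s)\<^sup>2 / (real_of_int (width u - 2))\<^sup>2 \<le> 648 * (1 + s)\<^sup>2 / 1" if "u \<in> intermediate"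
    using that s by (intro divide_left_mono one_le_power) (auto simp: intermediate_def)
  moreover have "0 \<le> 648 * (1 + s)\<^sup>2" by simp
  ultimately show ?thesis using s unfolding moment_gain_def by (cases "u \<in> intermediate"; cases "u \<in> narrow"; simp only: if_True if_False simp_thms; linarith)
qed

lemma expectation_moment_gain_le:
  "1 + (\<integral>u. moment_gain u \<partial>dlap \<epsilon>' 0) \<le> round_growth"
proof -
  let ?p = "dlap \<epsilon>' 0"
  let ?c = "exp (((1 + s) * (3 * \<epsilon>'))\<^sup>2) - 1"
  let ?g = "\<lambda>u. if u \<in> intermediate then 648 * (1 + s)\<^sup>2 / (real_of_int (width u - 2))\<^sup>2 else 0"
  let ?h = "\<lambda>u. if u \<in> narrow then s else 0"
  have ig: "integrable ?p ?g"
  proof (rule integrable_pmf_bounded[where c = "648 * (1 + s)\<^sup>2"])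
    fix u
    have "648 * (1 + s)\<^sup>2 / (real_of_int (width u - 2))\<^sup>2 \<le> 648 * (1 + s)\<^sup>2 / 1" if "u \<in> intermediate"
      using that s by (intro divide_left_mono one_le_power) (auto simp: intermediate_def)
    then show "\<bar>?g u\<bar> \<le> 648 * (1 + s)\<^sup>2" by auto
  qed
  have ih: "integrable ?p ?h" using s by (intro integrable_pmf_bounded[where c = s]) auto
  have "(\<integral>u. ?g u \<partial>?p) = (\<Sum>u\<in>intermediate. pmf ?p u * (648 * (1 + s)\<^sup>2 / (real_of_int (width u - 2))\<^sup>2))"
    by (subst integral_measure_pmf[OF finite_intermediate]) (auto split: if_splits)
  \<comment> \<open>Each point mass is at most \<open>\<pi>\<close> and the inverse squares are
    summable, so the number of intermediate widths, which may grow like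
    \<open>1 / \<epsilon>'\<close>, does not enter.\<close>
  also have "\<dots> \<le> (\<Sum>u\<in>intermediate. \<pi> * (648 * (1 + s)\<^sup>2 / (real_of_int (width u - 2))\<^sup>2))"
    by (intro sum_mono mult_right_mono pmf_le_pi) (auto simp: intermediate_def)
  also have "\<dots> = \<pi> * (648 * (1 + s)\<^sup>2) * (\<Sum>u\<in>intermediate. 1 / (real_of_int (width u - 2))\<^sup>2)"
    by (simp add: sum_distrib_left)
  also have "\<dots> \<le> \<pi> * (648 * (1 + s)\<^sup>2) * (1 / (18 * (1 + s) - 1))"
    using pi_nonneg by (intro mult_left_mono sum_intermediate_le) auto
  finally have g: "(\<integral>u. ?g u \<partial>?p) \<le> \<pi> * (648 * (1 + s)\<^sup>2 / (18 * (1 + s) - 1))" by simp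
  have "(\<integral>u. ?h u \<partial>?p) = (\<integral>u. s * indicator narrow u \<partial>?p)"
    by (intro Bochner_Integration.integral_cong) (auto simp: indicator_def)
  also have "\<dots> = s * measure ?p narrow" by simp
  also have "\<dots> \<le> s * (\<pi> * (18 * (1 + s) + 6))" using prob_narrow_le s by (intro mult_left_mono) auto
  finally have h: "(\<integral>u. ?h u \<partial>?p) \<le> \<pi> * (s * (18 * (1 + s) + 6))" by (simp add: algebra_simps)
  have "(\<integral>u. moment_gain u \<partial>?p) = (\<integral>u. ?c + ?g u + ?h u \<partial>?p)"
    unfolding moment_gain_def by simp
  also have "\<dots> = ?c + (\<integral>u. ?g u \<partial>?p) + (\<integral>u. ?h u \<partial>?p)"
    using ig ih by (simp del: of_int_diff)
  finally show ?thesis using g h by (simp add: round_growth_def algebra_simps)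
qed

lemma round_growth_ge_1: "1 \<le> round_growth"
proof -
  have "0 \<le> (\<integral>u. moment_gain u \<partial>dlap \<epsilon>' 0)"
    using moment_gain_nonneg by (intro Bochner_Integration.integral_nonneg) auto
  then show ?thesis using expectation_moment_gain_le by linarith
qed

section \<open>Trade-off for one run and its composition over all runs\<close>

abbreviation pass where
  "pass N q d i out u \<equiv> bt_inner \<epsilon>' N q d (A - u) (B + u) i True out"

text \<open>Noise \<open>u\<close> on \<open>d\<close> is paired with \<open>u - 1\<close> on
  \<open>d'\<close>, whose interval is shorter by one at each end. An interval without integers is
  never hit. Widths \<open>1\<close> and \<open>2\<close> are excluded since there the shrunk
  interval is empty while the original can be hit.\<close>

lemma pmf_pass_shift:
  assumes q: "\<And>i. i \<in> {1..N} \<Longrightarrow> \<bar>q i d - q i d'\<bar> \<le> 1" and i: "1 \<le> i"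
    and u: "width u \<le> 0 \<or> 3 \<le> width u"
  shows "pmf (dlap \<epsilon>' 0) u * pmf (pass N q d i out u) x
    \<le> exp (8 / 3 * \<epsilon>' + (if 3 \<le> width u then 2 / (width u - 2) else 0))
      * (pmf (dlap \<epsilon>' 0) (u - 1) * pmf (pass N q d' i out (u - 1)) x)"
proof -
  let ?r = "if 3 \<le> width u then 2 / (real_of_int (width u - 2)) else 0"
  let ?\<rho> = "exp (2 / 3 * \<epsilon>' + ?r)"
  have ab: "A - (u - 1) = A - u + 1" "B + (u - 1) = B + u - 1" by simp_all
  have "pmf (pass N q d i out u) x \<le> exp \<epsilon>' * ?\<rho> * pmf (pass N q d' i out (u - 1)) x"
    unfolding ab
  proof (rule pmf_bt_inner_shrink[where q = q and d = d and d' = d', OF \<epsilon>' q _ _ i])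
    show "1 \<le> ?\<rho>" using \<epsilon>' by auto
    fix t t' :: int assume t: "\<bar>t - t'\<bar> \<le> 1"
    show "measure (dlap (\<epsilon>' / 3) t) {A - u<..<B + u} \<le> ?\<rho> * measure (dlap (\<epsilon>' / 3) t') {A - u + 1<..<B + u - 1}"
    proof (cases "3 \<le> width u")
      case True
      have k: "B + u - (A - u) - 1 = width u" "B + u - (A - u) - 3 = width u - 2"
        by (simp_all add: width_def)
      let ?j = "real_of_int (width u - 2)"
      have j: "?j > 0" using True by simp
      have "real_of_int (width u) / ?j = 1 + 2 / ?j" using j by (simp add: field_simps)
      also have "\<dots> \<le> exp (2 / ?j)" by (rule exp_ge_add_one_self)
      finally have "exp (2 * (\<epsilon>' / 3)) * (real_of_int (width u) / ?j) \<le> exp (2 * (\<epsilon>' / 3)) * exp (2 / ?j)"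
        by (intro mult_left_mono) auto
      also have "\<dots> = ?\<rho>" using True by (simp add: exp_add)
      finally have "exp (2 * (\<epsilon>' / 3)) * (real_of_int (width u) / ?j) \<le> ?\<rho>" .
      moreover have "measure (dlap (\<epsilon>' / 3) t) {A - u<..<B + u}
          \<le> exp (2 * (\<epsilon>' / 3)) * (real_of_int (width u) / ?j) * measure (dlap (\<epsilon>' / 3) t') {A - u + 1<..<B + u - 1}"
        using dlap_interval_shrink[of "\<epsilon>' / 3" t t' "A - u" "B + u"] \<epsilon>' t True unfolding k by (simp add: width_def)
      ultimately show ?thesis by (smt (verit) mult_right_mono measure_nonneg)
    next
      case False
      then have "{A - u<..<B + u} = {}" using u by (auto simp: width_def)
      then show ?thesis by simp
    qed
  qed
  then have "pmf (dlap \<epsilon>' 0) u * pmf (pass N q d i out u) x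
      \<le> (exp \<epsilon>' * pmf (dlap \<epsilon>' 0) (u - 1)) * (exp \<epsilon>' * ?\<rho> * pmf (pass N q d' i out (u - 1)) x)"
    using pmf_dlap_shift[OF \<epsilon>', of u 0 "u - 1" 0 1] by (intro mult_mono) auto
  also have "\<dots> = (exp \<epsilon>' * exp \<epsilon>' * ?\<rho>) * (pmf (dlap \<epsilon>' 0) (u - 1) * pmf (pass N q d' i out (u - 1)) x)"
    by simp
  \<comment> \<open>One \<open>exp \<epsilon>'\<close> shifts the threshold noise, one covers the
    noisy answer, and \<open>2 / 3 * \<epsilon>'\<close> comes from the interval.\<close>
  also have "exp \<epsilon>' * exp \<epsilon>' * ?\<rho> = exp (8 / 3 * \<epsilon>' + ?r)"
    by (simp flip: exp_add)
  finally show ?thesis .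
qed

lemma loss_le: "loss u \<le> 8 / 3 * \<epsilon>' + 2"
proof -
  have "2 / (real_of_int (width u) - 2) \<le> 2 / 1" if "cutoff + 2 < width u"
  proof (rule divide_left_mono)
    have "2 < width u" using that cutoff_bounds(1) by linarith
    then show "1 \<le> real_of_int (width u) - 2" by linarith
    then show "0 < (real_of_int (width u) - 2) * 1" by simp
  qed simp
  then show ?thesis by (auto simp: loss_def)
qed

text \<open>The likelihood ratio is enclosed by \<open>exp (loss u)\<close> and
  \<open>exp (- loss u)\<close>, the latter replaced by \<open>0\<close> on \<open>narrow\<close>.
  Both bounds arise from the shift of \<open>u\<close> to \<open>u - 1\<close>, with the roles of
  \<open>d\<close> and \<open>d'\<close> exchanged.\<close>

lemma round_tradeoff:
  fixes q :: "nat \<Rightarrow> 'd \<Rightarrow> int" and F F' :: "nat \<times> (nat \<times> int) list \<Rightarrow> real"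
  assumes q: "\<And>i. i \<in> {1..N} \<Longrightarrow> \<bar>q i d - q i d'\<bar> \<le> 1" and i: "1 \<le> i"
    and t: "t > 0" and a: "a \<ge> 0" and b: "b \<ge> 0"
    and F: "\<And>x. 0 \<le> F x" "\<And>x. F x \<le> 1" and F': "\<And>x. 0 \<le> F' x" "\<And>x. F' x \<le> 1"
    and FF': "\<And>x t. x \<in> set_pmf (bind_pmf (dlap \<epsilon>' 0) (pass N q d i out)) \<Longrightarrow> t > 0
      \<Longrightarrow> F x \<le> t * F' x + a * t powr - s + b"
  shows "(\<integral>x. F x \<partial>bind_pmf (dlap \<epsilon>' 0) (pass N q d i out))
    \<le> t * (\<integral>x. F' x \<partial>bind_pmf (dlap \<epsilon>' 0) (pass N q d' i out))
      + a * round_growth * t powr - s + b + \<pi> * (18 * (1 + s) + 6)"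
proof -
  let ?p = "dlap \<epsilon>' 0" and ?f = "pass N q d i out" and ?g = "pass N q d' i out"
  let ?lo = "\<lambda>u. if u \<in> narrow then 0 else exp (- loss u)"
  let ?L = "exp (8 / 3 * \<epsilon>' + 2)"
  have q': "\<bar>q i d' - q i d\<bar> \<le> 1" if "i \<in> {1..N}" for i using q[OF that] by linarith
  have hi1: "1 \<le> exp (loss u)" and lo1: "exp (- loss u) \<le> 1" and hiL: "exp (loss u) \<le> ?L" for u
    using loss_nonneg loss_le by auto
  have le1: "x * y \<le> c" if "0 \<le> x" "x \<le> c" "y \<le> 1" for x y c :: real
    using mult_left_mono[of y 1 x] that by auto
  have shift: "bij (\<lambda>u :: int. u - 1)" by (simp add: bij_diff_right)
  have up: "(\<integral>u. indicator (- discarded) u * pmf (?f u) x \<partial>?p) \<le> (\<integral>u. exp (loss u) * pmf (?g u) x \<partial>?p)" for x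
  proof (rule integral_pmf_le_shift[OF shift, where c = 1 and c' = ?L])
    fix u
    show "pmf ?p u * (indicator (- discarded) u * pmf (?f u) x)
        \<le> pmf ?p (u - 1) * (exp (loss (u - 1)) * pmf (?g (u - 1)) x)"
    proof (cases "u \<in> discarded")
      case False
      then have w: "width u \<le> 0 \<or> cutoff + 4 < width u" by (auto simp: discarded_def)
      then have "pmf ?p u * pmf (?f u) x
          \<le> exp (8 / 3 * \<epsilon>' + (if 3 \<le> width u then 2 / (width u - 2) else 0)) * (pmf ?p (u - 1) * pmf (?g (u - 1)) x)"
        using cutoff_bounds by (intro pmf_pass_shift q i) auto
      also have "\<dots> \<le> exp (loss (u - 1)) * (pmf ?p (u - 1) * pmf (?g (u - 1)) x)"
      proof (intro mult_right_mono)
        \<comment> \<open>The loss is taken at the shifted noise, whose width is smaller by two;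
          hence the denominator \<open>width u - 4\<close>.\<close>
        have "2 / (real_of_int (width u) - 2) \<le> 2 / (real_of_int (width u) - 4)" if "cutoff + 4 < width u"
          using that cutoff_bounds by (intro divide_left_mono) auto
        then show "exp (8 / 3 * \<epsilon>' + (if 3 \<le> width u then 2 / (width u - 2) else 0)) \<le> exp (loss (u - 1))"
          using w cutoff_bounds(1) by (auto simp: loss_def width_shift)
      qed auto
      finally show ?thesis using False by (simp add: mult_ac)
    qed auto
    show "exp (loss u) * pmf (?g u) x \<le> ?L" by (rule le1[OF _ hiL pmf_le_1]) simp
  qed (auto simp: indicator_def pmf_le_1)
  have down: "(\<integral>u. ?lo u * pmf (?g u) x \<partial>?p) \<le> (\<integral>u. indicator (- discarded) u * pmf (?f u) x \<partial>?p)" for x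
  proof (rule integral_pmf_le_shift[OF shift, where c = 1 and c' = 1])
    fix u
    show "pmf ?p u * (?lo u * pmf (?g u) x)
        \<le> pmf ?p (u - 1) * (indicator (- discarded) (u - 1) * pmf (?f (u - 1)) x)"
    proof (cases "u \<in> narrow")
      case False
      then have w: "width u \<le> 0 \<or> cutoff + 6 < width u" by (auto simp: narrow_def)
      then have nd: "u - 1 \<notin> discarded" by (auto simp: discarded_def width_shift)
      have "pmf ?p u * pmf (?g u) x
          \<le> exp (8 / 3 * \<epsilon>' + (if 3 \<le> width u then 2 / (width u - 2) else 0)) * (pmf ?p (u - 1) * pmf (?f (u - 1)) x)"
        using w cutoff_bounds by (intro pmf_pass_shift q' i) auto
      also have "8 / 3 * \<epsilon>' + (if 3 \<le> width u then 2 / (width u - 2) else 0) = loss u"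
        using w cutoff_bounds by (auto simp: loss_def)
      finally have "exp (- loss u) * (pmf ?p u * pmf (?g u) x)
          \<le> exp (- loss u) * (exp (loss u) * (pmf ?p (u - 1) * pmf (?f (u - 1)) x))"
        by (intro mult_left_mono) auto
      also have "\<dots> = pmf ?p (u - 1) * pmf (?f (u - 1)) x"
        by (simp flip: mult.assoc exp_add)
      finally show ?thesis using False nd by (simp add: mult_ac)
    qed auto
  qed (auto simp: indicator_def pmf_le_1 loss_nonneg intro!: le1)
  have G: "excess s (exp (loss u)) \<le> moment_gain u" for u
    using loss_nonneg by (intro excess_loss_le) auto
  have G0: "excess s (?lo u) \<le> moment_gain u" for u
  proof (cases "u \<in> narrow")
    case True
    then have "excess s (?lo u) \<le> s" using s by (simp add: excess_def)
    also have "s \<le> moment_gain u" using True s by (auto simp: moment_gain_def)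
    finally show ?thesis .
  next
    case False
    then show ?thesis using excess_loss_le[of "- loss u" u] loss_nonneg by simp
  qed
  have "(\<integral>x. F x \<partial>bind_pmf ?p ?f) \<le> t * (\<integral>x. F' x \<partial>bind_pmf ?p ?g)
      + a * (1 + (\<integral>u. moment_gain u \<partial>?p)) * t powr - s + b + measure ?p discarded"
    using s lo1
    by (intro expectation_bind_tradeoff[where hi = "\<lambda>u. exp (loss u)" and lo = ?lo and H = ?L
          and K = "exp (((1 + s) * (3 * \<epsilon>'))\<^sup>2) + 648 * (1 + s)\<^sup>2 + s"]
        t a b F F' FF' up down G G0 hi1 hiL moment_gain_nonneg moment_gain_le) auto
  also have "\<dots> \<le> t * (\<integral>x. F' x \<partial>bind_pmf ?p ?g)
      + a * round_growth * t powr - s + b + \<pi> * (18 * (1 + s) + 6)"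
    using a by (intro add_mono mult_right_mono mult_left_mono expectation_moment_gain_le prob_discarded_le order_refl) auto
  finally show ?thesis .
qed

text \<open>Induction over the remaining queries: each run contributes one factor
  \<open>round_growth\<close> and one charge for discarded noise. The bound is kept for all
  \<open>t\<close> because \<open>round_tradeoff\<close> rescales it at each outcome.\<close>

lemma bt_outer_tradeoff:
  fixes q :: "nat \<Rightarrow> 'd \<Rightarrow> int"
  assumes q: "\<And>i. i \<in> {1..N} \<Longrightarrow> \<bar>q i d - q i d'\<bar> \<le> 1" and i: "1 \<le> i" and t: "t > 0"
  shows "measure (bt_outer \<epsilon>' N C A B q d i out) S
    \<le> t * measure (bt_outer \<epsilon>' N C A B q d' i out) S
      + round_growth ^ (C - length out) * t powr - s + real (C - length out) * (\<pi> * (18 * (1 + s) + 6))"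
  using i t
proof (induction "N + 1 - i" arbitrary: i out t rule: less_induct)
  case less
  let ?P = "\<lambda>d (i, out). measure (bt_outer \<epsilon>' N C A B q d i out) S"
  let ?\<delta> = "\<pi> * (18 * (1 + s) + 6)"
  have \<delta>0: "0 \<le> ?\<delta>" using pi_nonneg s by auto
  have stop: "?P d (i, out) \<le> t * ?P d' (i, out) + a * t powr - s + b"
    if "\<not> (i \<le> N \<and> length out < C)" "0 < t" "1 \<le> a" "0 \<le> b" for i out t a b
  proof -
    \<comment> \<open>After stopping, both output distributions agree; the bound holds because
      \<open>t\<close> or \<open>t powr - s\<close> is at least one.\<close>
    have "1 \<le> t + t powr - s"
    proof (cases "t \<ge> 1")
      case False
      then have "1 \<le> t powr - s" using powr_mono2'[of "- s" t 1] that s by simp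
      then show ?thesis using that by linarith
    qed (simp add: add_increasing2)
    moreover have "t powr - s \<le> a * t powr - s" using mult_right_mono[of 1 a "t powr - s"] that by simp
    ultimately have "1 \<le> t + a * t powr - s" by linarith
    moreover have "0 \<le> a * t powr - s" using that by simp
    moreover have "bt_outer \<epsilon>' N C A B q d i out = return_pmf out" "bt_outer \<epsilon>' N C A B q d' i out = return_pmf out"
      using that(1) by (subst bt_outer.simps, subst if_not_P; blast)+
    ultimately show ?thesis using that by (simp add: indicator_def)
  qed
  show ?case
  proof (cases "i \<le> N \<and> length out < C")
    case False
    with stop[OF False less.prems(2), of "round_growth ^ (C - length out)" "real (C - length out) * ?\<delta>"]
    show ?thesis using \<delta>0 round_growth_ge_1 by simp
  next
    case True
    let ?m = "C - Suc (length out)"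
    have m: "C - length out = Suc ?m" using True by (simp add: Suc_diff_Suc)
    have unfold: "?P e (i, out) = (\<integral>x. ?P e x \<partial>bind_pmf (dlap \<epsilon>' 0) (pass N q e i out))" for e
    proof -
      have "bt_outer \<epsilon>' N C A B q e i out
          = bind_pmf (bind_pmf (dlap \<epsilon>' 0) (pass N q e i out)) (\<lambda>(i', out'). bt_outer \<epsilon>' N C A B q e i' out')"
        using True by (subst bt_outer.simps) (simp add: bind_assoc_pmf)
      then have "ennreal (?P e (i, out)) = (\<integral>\<^sup>+x. ennreal (?P e x) \<partial>bind_pmf (dlap \<epsilon>' 0) (pass N q e i out))"
        by (simp add: measure_pmf.emeasure_eq_measure[symmetric] case_prod_beta)
      also have "\<dots> = ennreal (\<integral>x. ?P e x \<partial>bind_pmf (dlap \<epsilon>' 0) (pass N q e i out))"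
        by (intro nn_integral_eq_integral integrable_pmf_bounded[where c = 1]) auto
      finally show ?thesis
        by (subst (asm) ennreal_inj) (auto intro!: Bochner_Integration.integral_nonneg)
    qed
    have "?P d x \<le> \<tau> * ?P d' x + round_growth ^ ?m * \<tau> powr - s + real ?m * ?\<delta>"
      if x: "x \<in> set_pmf (bind_pmf (dlap \<epsilon>' 0) (pass N q d i out))" and \<tau>: "\<tau> > 0" for x \<tau>
    proof -
      obtain i' out' where x': "x = (i', out')" by (cases x)
      from x obtain u where u: "(i', out') \<in> set_pmf (pass N q d i out u)" unfolding x' by auto
      have i': "i < i'" using bt_inner_index_gr[OF u] True by simp
      show ?thesis
      proof (cases "i' \<le> N")
        \<comment> \<open>The run may have ended without a new output, but no query remains, so
          \<open>stop\<close> applies with the constants of the next level.\<close>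
        case False
        then show ?thesis
          unfolding x' using \<tau> \<delta>0 round_growth_ge_1 by (intro stop) auto
      next
        case True
        with bt_inner_outcome[OF u] have "length out' = Suc (length out)" by simp
        then show ?thesis
          using less.hyps[of i' \<tau> out'] i' True \<tau> less.prems by (simp add: x')
      qed
    qed
    then have "(\<integral>x. ?P d x \<partial>bind_pmf (dlap \<epsilon>' 0) (pass N q d i out))
        \<le> t * (\<integral>x. ?P d' x \<partial>bind_pmf (dlap \<epsilon>' 0) (pass N q d' i out))
          + round_growth ^ ?m * round_growth * t powr - s + real ?m * ?\<delta> + ?\<delta>"
      using less.prems \<delta>0 round_growth_ge_1 by (intro round_tradeoff q) auto
    then show ?thesis
      unfolding unfold[symmetric] m by (simp add: algebra_simps)
  qed
qed

end

section \<open>Choice of the parameters\<close>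

lemma exp_one_le: "exp (1 :: real) \<le> 272 / 100"
  using e_less_272 by simp

text \<open>Half of the gap \<open>B - A\<close> enters the exponent: its first logarithm
  contributes \<open>(\<epsilon>' / 4) ^ 3\<close>, the second \<open>\<delta> * c / 2\<close>. The
  fourth factor \<open>\<epsilon>'\<close> comes from \<open>pmf_dlap_le\<close>, and
  \<open>55\<close> bounds \<open>exp 4\<close>.\<close>

lemma pmf_dlap_narrow_le:
  fixes \<epsilon>' \<delta> c :: real and A B u :: int
  assumes \<epsilon>': "0 < \<epsilon>'" "\<epsilon>' \<le> 1 / 6" and \<delta>: "0 < \<delta>" and c: "0 < c"
    and AB: "real_of_int (B - A) \<ge> 6 / \<epsilon>' * ln (4 / \<epsilon>') + 2 / \<epsilon>' * ln (2 / (\<delta> * c))"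
    and u: "real_of_int (B - A + 2 * u - 1) \<le> 6 / \<epsilon>' + 6"
  shows "pmf (dlap \<epsilon>' 0) u \<le> 55 / 128 * \<epsilon>' ^ 4 * \<delta> * c"
proof -
  have "2 * real_of_int u \<le> 6 / \<epsilon>' + 7 - real_of_int (B - A)" using u by simp
  also have "\<dots> \<le> 6 / \<epsilon>' + 7 - (6 / \<epsilon>' * ln (4 / \<epsilon>') + 2 / \<epsilon>' * ln (2 / (\<delta> * c)))" using AB by simp
  finally have "\<epsilon>' * (2 * real_of_int u)
      \<le> \<epsilon>' * (6 / \<epsilon>' + 7 - (6 / \<epsilon>' * ln (4 / \<epsilon>') + 2 / \<epsilon>' * ln (2 / (\<delta> * c))))"
    using \<epsilon>' by (intro mult_left_mono) auto
  also have "\<dots> = 6 + 7 * \<epsilon>' - 6 * ln (4 / \<epsilon>') - 2 * ln (2 / (\<delta> * c))"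
    using \<epsilon>' by (simp add: algebra_simps)
  \<comment> \<open>Here \<open>6 + 7 * \<epsilon>' \<le> 8\<close>, because
    \<open>\<epsilon>' \<le> 1 / 6\<close>.\<close>
  finally have le: "\<epsilon>' * real_of_int u \<le> 4 - 3 * ln (4 / \<epsilon>') - ln (2 / (\<delta> * c))" using \<epsilon>' by linarith
  have "exp (4 :: real) = exp 1 ^ 4" by (simp flip: exp_of_nat_mult)
  also have "\<dots> \<le> (272 / 100) ^ 4" using exp_one_le by (intro power_mono) auto
  finally have e4: "exp (4 :: real) \<le> 55" by (simp add: power4_eq_xxxx)
  have "exp (3 * ln (4 / \<epsilon>')) = exp (ln (4 / \<epsilon>')) ^ 3"
    by (simp flip: exp_of_nat_mult)
  also have "\<dots> = (4 / \<epsilon>') ^ 3" using \<epsilon>' by simp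
  finally have l3: "exp (3 * ln (4 / \<epsilon>')) = (4 / \<epsilon>') ^ 3" .
  have "pmf (dlap \<epsilon>' 0) u \<le> \<epsilon>' * exp (\<epsilon>' * u)" by (rule pmf_dlap_le[OF \<epsilon>'(1)])
  also have "\<dots> \<le> \<epsilon>' * exp (4 - 3 * ln (4 / \<epsilon>') - ln (2 / (\<delta> * c)))"
    using le \<epsilon>' by simp
  also have "\<dots> = \<epsilon>' * (exp 4 / (4 / \<epsilon>') ^ 3 / (2 / (\<delta> * c)))"
    using \<delta> c by (simp add: exp_diff l3)
  also have "\<dots> \<le> \<epsilon>' * (55 / (4 / \<epsilon>') ^ 3 / (2 / (\<delta> * c)))"
    using e4 \<epsilon>' \<delta> c by (intro mult_left_mono divide_right_mono) auto
  also have "\<dots> = 55 / 128 * \<epsilon>' ^ 4 * \<delta> * c"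
    using \<epsilon>' \<delta> c by (simp add: field_simps power3_eq_cube power4_eq_xxxx)
  finally show ?thesis .
qed

lemma ln_two_div_ge:
  fixes \<delta> :: real
  assumes "0 < \<delta>" "\<delta> < 1"
  shows "2 / 3 \<le> ln (2 / \<delta>)"
proof -
  have "2 / 3 \<le> ln (2 :: real)" by (rule ln2_ge_two_thirds)
  also have "\<dots> \<le> ln (2 / \<delta>)" using assms by (subst ln_le_cancel_iff) (auto simp: field_simps)
  finally show ?thesis .
qed

text \<open>\<open>\<epsilon>' ^ 4\<close> contains \<open>1 / c\<^sup>2\<close>, which cancels the
  factor \<open>c\<close> in \<open>\<pi>\<close> and the one for the number of runs; in the second
  estimate \<open>\<epsilon>'\<^sup>2\<close> cancels the latter. Throughout \<open>v\<close> plays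
  the part of \<open>1 + s\<close>, and
  \<open>v * \<epsilon> \<le> 9 / 2 * \<Lambda>\<close>.\<close>

lemma round_budget:
  fixes \<epsilon> \<delta> \<Lambda> c \<epsilon>' v \<pi> :: real
  assumes \<epsilon>: "0 < \<epsilon>" "\<epsilon> \<le> 1" and \<delta>: "0 < \<delta>" and \<Lambda>: "2 / 3 \<le> \<Lambda>" and c: "1 \<le> c"
  defines "v \<equiv> 1 + 3 * \<Lambda> / \<epsilon>" and "\<pi> \<equiv> 55 / 128 * \<epsilon>' ^ 4 * \<delta> * c"
  assumes \<epsilon>': "\<epsilon>'\<^sup>2 = \<epsilon>\<^sup>2 / (72 * c * \<Lambda>)"
  shows "c * (\<pi> * v\<^sup>2) \<le> \<delta> / 500" and "c * (v * (3 * \<epsilon>'))\<^sup>2 \<le> 9 / 8 * \<Lambda> + 15 / 16"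
proof -
  have v: "v * \<epsilon> = \<epsilon> + 3 * \<Lambda>" "0 \<le> v" using \<epsilon> \<Lambda> by (simp_all add: v_def field_simps)
  have "\<epsilon>' ^ 4 = (\<epsilon>'\<^sup>2)\<^sup>2" by (simp flip: power_mult)
  also have "\<dots> = \<epsilon> ^ 4 / (5184 * c\<^sup>2 * \<Lambda>\<^sup>2)" unfolding \<epsilon>'
    by (simp add: power_divide power_mult_distrib flip: power_mult)
  finally have \<epsilon>4: "\<epsilon>' ^ 4 = \<epsilon> ^ 4 / (5184 * c\<^sup>2 * \<Lambda>\<^sup>2)" .
  have "c * (\<pi> * v\<^sup>2) = 55 / 663552 * \<delta> * \<epsilon>\<^sup>2 * ((v * \<epsilon>)\<^sup>2 / \<Lambda>\<^sup>2)"
    using c \<Lambda> unfolding \<pi>_def \<epsilon>4 by (simp add: field_simps power2_eq_square power4_eq_xxxx)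
  also have "\<dots> \<le> 55 / 663552 * \<delta> * 1 * (81 / 4)"
  proof (intro mult_mono)
    show "\<epsilon>\<^sup>2 \<le> 1" using \<epsilon> by (intro power_le_one) auto
    have "(v * \<epsilon>)\<^sup>2 \<le> (9 / 2 * \<Lambda>)\<^sup>2" unfolding v using \<epsilon> \<Lambda> by (intro power_mono) auto
    then show "(v * \<epsilon>)\<^sup>2 / \<Lambda>\<^sup>2 \<le> 81 / 4" using \<Lambda> by (simp add: field_simps power2_eq_square)
  qed (use \<delta> in auto)
  also have "\<dots> \<le> \<delta> / 500" using \<delta> by simp
  finally show "c * (\<pi> * v\<^sup>2) \<le> \<delta> / 500" .
  have "c * (v * (3 * \<epsilon>'))\<^sup>2 = 9 * c * v\<^sup>2 * \<epsilon>'\<^sup>2" by (simp add: power_mult_distrib)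
  also have "\<dots> = (v * \<epsilon>)\<^sup>2 / (8 * \<Lambda>)"
    using c \<Lambda> unfolding \<epsilon>' by (simp add: field_simps)
  also have "\<dots> = 9 / 8 * \<Lambda> + 3 / 4 * \<epsilon> + \<epsilon>\<^sup>2 / (8 * \<Lambda>)"
    using \<Lambda> unfolding v by (simp add: field_simps power2_eq_square)
  also have "\<epsilon>\<^sup>2 / (8 * \<Lambda>) \<le> 1 / (8 * (2 / 3))"
    using \<epsilon> \<Lambda> power_le_one[of \<epsilon> 2] by (intro frac_le) auto
  finally show "c * (v * (3 * \<epsilon>'))\<^sup>2 \<le> 9 / 8 * \<Lambda> + 15 / 16" using \<epsilon> by simp
qed

theorem theorem5p33:
  fixes Adj :: "('d \<times> 'd) set"
    and \<epsilon> \<delta> \<epsilon>' :: real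
    and N C :: nat
    and q :: "nat \<Rightarrow> 'd \<Rightarrow> int"
    and A B :: int
  assumes "0 < \<epsilon>" "\<epsilon> < 1"
    and "0 < \<delta>" "\<delta> < 1"
    and "C \<ge> 1"
    and "\<And>i. i \<in> {1..N} \<Longrightarrow> one_sensitive Adj (q i)"
    and "\<epsilon>' = \<epsilon> / (6 * sqrt (2 * real C * ln (2 / \<delta>)))"
    and "real_of_int (B - A) \<ge> 6 / \<epsilon>' * ln (4 / \<epsilon>') + 2 / \<epsilon>' * ln (2 / (\<delta> * real C))"
  shows "differentially_private \<epsilon> \<delta> Adj (between_thresholds \<epsilon>' N C A B q)"
proof -
  note \<epsilon> = assms(1,2) and \<delta> = assms(3,4)
  define \<Lambda> where "\<Lambda> = ln (2 / \<delta>)"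
  \<comment> \<open>This order makes \<open>exp \<epsilon> powr - s\<close> equal to
    \<open>exp (- 3 * \<Lambda>)\<close>, against a growth of about
    \<open>exp (9 / 8 * \<Lambda>)\<close>. Since \<open>exp (- \<Lambda>) = \<delta> / 2\<close>,
    enough is left for the constants.\<close>
  define s where "s = 3 * \<Lambda> / \<epsilon>"
  define \<pi> where "\<pi> = 55 / 128 * \<epsilon>' ^ 4 * \<delta> * real C"
  let ?c = "real C"
  have c: "1 \<le> ?c" using assms(5) by simp
  have \<Lambda>: "2 / 3 \<le> \<Lambda>" unfolding \<Lambda>_def using \<delta> by (rule ln_two_div_ge)
  have \<epsilon>'0: "0 < \<epsilon>'" using \<epsilon> \<Lambda> c assms(7) by (simp add: \<Lambda>_def)
  have \<epsilon>'2: "\<epsilon>'\<^sup>2 = \<epsilon>\<^sup>2 / (72 * ?c * \<Lambda>)"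
    using \<Lambda> c unfolding assms(7) \<Lambda>_def[symmetric] by (simp add: power_divide power_mult_distrib)
  have "\<epsilon>\<^sup>2 / (72 * ?c * \<Lambda>) \<le> 1 / (72 * 1 * (2 / 3))"
    using \<epsilon> \<Lambda> c by (intro frac_le mult_mono power_le_one) auto
  then have "\<epsilon>'\<^sup>2 \<le> (1 / 6)\<^sup>2" unfolding \<epsilon>'2 by (simp add: power2_eq_square)
  then have \<epsilon>'6: "\<epsilon>' \<le> 1 / 6" by (rule power2_le_imp_le) simp
  have s2: "2 \<le> s" using \<epsilon> \<Lambda> by (simp add: s_def field_simps)
  interpret noisy_thresholds \<epsilon>' s \<pi> A B
  proof
    show "pmf (dlap \<epsilon>' 0) u \<le> \<pi>" if "real_of_int (B - A + 2 * u - 1) \<le> 6 / \<epsilon>' + 6" for u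
      unfolding \<pi>_def using \<epsilon>'0 \<epsilon>'6 \<delta>(1) c assms(8) that by (intro pmf_dlap_narrow_le) auto
  qed (fact \<epsilon>'0 s2)+
  define v where "v = 1 + s"
  have v3: "3 \<le> v" using s2 by (simp add: v_def)
  have budget: "?c * (\<pi> * v\<^sup>2) \<le> \<delta> / 500" "?c * (v * (3 * \<epsilon>'))\<^sup>2 \<le> 9 / 8 * \<Lambda> + 15 / 16"
    unfolding v_def s_def \<pi>_def using round_budget[OF \<epsilon>(1) _ \<delta>(1) \<Lambda> c \<epsilon>'2] \<epsilon>(2) by auto
  have vv: "3 * v \<le> v\<^sup>2" using v3 by (simp add: power2_eq_square)
  have \<pi>0: "0 \<le> \<pi>" by (rule pi_nonneg)
  have "648 * v\<^sup>2 / (18 * v - 1) \<le> 648 * v\<^sup>2 / (17 * v)"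
    using v3 by (intro divide_left_mono) auto
  also have "\<dots> = 648 / 17 * v" using v3 by (simp add: power2_eq_square)
  finally have r1: "648 * v\<^sup>2 / (18 * v - 1) \<le> 13 * v\<^sup>2" using vv v3 by simp
  have "s * (18 * v + 6) \<le> v * (20 * v)" using v3 s2 by (intro mult_mono) (auto simp: v_def)
  then have r2: "s * (18 * v + 6) \<le> 20 * v\<^sup>2" by (simp add: power2_eq_square)
  have "round_growth \<le> exp ((v * (3 * \<epsilon>'))\<^sup>2) + \<pi> * (33 * v\<^sup>2)"
    unfolding round_growth_def v_def[symmetric] using r1 r2 \<pi>0 by (intro add_left_mono mult_left_mono) auto
  also have "\<dots> \<le> exp ((v * (3 * \<epsilon>'))\<^sup>2) * (1 + \<pi> * (33 * v\<^sup>2))"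
    using \<pi>0 mult_right_mono[of 1 "exp ((v * (3 * \<epsilon>'))\<^sup>2)" "\<pi> * (33 * v\<^sup>2)"] by (simp add: distrib_left)
  also have "\<dots> \<le> exp ((v * (3 * \<epsilon>'))\<^sup>2) * exp (\<pi> * (33 * v\<^sup>2))"
    by (intro mult_left_mono exp_ge_add_one_self) auto
  finally have growth: "round_growth \<le> exp ((v * (3 * \<epsilon>'))\<^sup>2 + \<pi> * (33 * v\<^sup>2))"
    by (simp add: exp_add)
  have "round_growth ^ C \<le> exp ((v * (3 * \<epsilon>'))\<^sup>2 + \<pi> * (33 * v\<^sup>2)) ^ C"
    using growth round_growth_ge_1 by (intro power_mono) auto
  also have "\<dots> = exp (?c * (v * (3 * \<epsilon>'))\<^sup>2 + 33 * (?c * (\<pi> * v\<^sup>2)))"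
    by (simp add: exp_of_nat_mult[symmetric] algebra_simps)
  \<comment> \<open>The spare \<open>7 / 8 * \<Lambda> \<ge> 7 / 12\<close> absorbs
    \<open>15 / 16 - 1 / 2\<close> and the \<open>33 * \<delta> / 500\<close> from
    \<open>budget\<close>.\<close>
  also have "\<dots> \<le> exp (2 * \<Lambda> + 1 / 2)"
    using budget \<delta> \<Lambda> by simp
  finally have "round_growth ^ C * exp \<epsilon> powr - s \<le> exp (2 * \<Lambda> + 1 / 2) * exp \<epsilon> powr - s"
    by (intro mult_right_mono) auto
  also have "\<dots> = exp (1 / 2 - \<Lambda>)"
    using \<epsilon> by (simp add: exp_powr_real s_def flip: exp_add)
  also have "\<dots> = exp (1 / 2) * (\<delta> / 2)"
    using \<delta> by (simp add: exp_diff \<Lambda>_def)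
  also have "exp (1 / 2 :: real) \<le> 5 / 3"
  proof (rule power2_le_imp_le)
    have "(exp (1 / 2 :: real))\<^sup>2 = exp 1" by (simp add: power2_eq_square flip: exp_add)
    then show "(exp (1 / 2 :: real))\<^sup>2 \<le> (5 / 3)\<^sup>2" using exp_one_le by (simp add: power2_eq_square)
  qed simp
  \<comment> \<open>Five sixths of \<open>\<delta>\<close> cover the moment term; the last sixth is
    left for the discarded noise in \<open>rest\<close>.\<close>
  finally have main: "round_growth ^ C * exp \<epsilon> powr - s \<le> 5 / 6 * \<delta>" using \<delta> by simp
  have "18 * v + 6 \<le> 20 / 3 * v\<^sup>2" using vv v3 by linarith
  then have "\<pi> * (18 * v + 6) \<le> \<pi> * (20 / 3 * v\<^sup>2)" using \<pi>0 by (rule mult_left_mono)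
  then have "?c * (\<pi> * (18 * v + 6)) \<le> ?c * (\<pi> * (20 / 3 * v\<^sup>2))"
    by (rule mult_left_mono) simp
  then have rest: "?c * (\<pi> * (18 * v + 6)) \<le> \<delta> / 6" using budget(1) \<delta> by simp
  show ?thesis
    unfolding differentially_private_def
  proof (intro ballI, clarify)
    fix d d' S assume adj: "(d, d') \<in> Adj"
    have q: "\<bar>q i d - q i d'\<bar> \<le> 1" if "i \<in> {1..N}" for i
      using assms(6)[OF that] adj by (auto simp: one_sensitive_def)
    have "measure (between_thresholds \<epsilon>' N C A B q d) S
        \<le> exp \<epsilon> * measure (between_thresholds \<epsilon>' N C A B q d') S
          + round_growth ^ C * exp \<epsilon> powr - s + ?c * (\<pi> * (18 * v + 6))"
      using bt_outer_tradeoff[of N q d d' 1 "exp \<epsilon>" C "[]" S] q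
      by (simp add: between_thresholds_def v_def)
    then show "measure (between_thresholds \<epsilon>' N C A B q d) S
        \<le> exp \<epsilon> * measure (between_thresholds \<epsilon>' N C A B q d') S + \<delta>"
      using main rest by linarith
  qed
qed

end
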